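(* Let $$\kappa_1=\frac{2\log\frac{1+\sqrt5}{2}}{\log2},\qquad \kappa_2=\frac{4\log\frac{5+\sqrt{29}}{2}-5\log(2+\sqrt5)}{\log\frac{5+\sqrt{29}}{2}-\log(2+\sqrt5)-\log\sqrt2}.$$ 1. If a real irrational $x\in(0,1)$ satisfies $\limsup_{t\to\infty}\frac{S_x(t)}{t}<\kappa_1$, then $?'(x)$ exists and $?'(x)=+\infty$. 2. There exists an irrational $x\in(0,1)$ such that $\lim_{t\to\infty}\frac{S_x(t)}{t}=\kappa_1$ and $?'(x)=0$. 3. If a real irrational $x\in(0,1)$ satisfies $\liminf_{t\to\infty}\frac{S_x(t)}{t}>\kappa_2$, then $?'(x)$ exists and $?'(x)=0$. 4. There exists an irrational $x\in(0,1)$ such that $\lim_{t\to\infty}\frac{S_x(t)}{t}=\kappa_2$ and $?'(x)=+\infty$.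
   Context: The Minkowski question mark function $?:[0,1]\to[0,1]$ is the continuous increasing function defined by $?(0)=0$, $?(1)=1$, by $?\left(\frac{p+p'}{q+q'}\right)=\frac12\left(?\left(\frac pq\right)+?\left(\frac{p'}{q'}\right)\right)$ for consecutive Farey fractions $\frac pq,\frac{p'}{q'}$, and extended by continuity to irrationals. Equivalently, for irrational $x=[0;a_1,a_2,\dots]$, $?(x)=\frac1{2^{a_1-1}}-\frac1{2^{a_1+a_2-1}}+\dots+\frac{(-1)^{n+1}}{2^{a_1+\dots+a_n-1}}+\cdots$. The derivative $?'(x)$ is understood as the limit of $\frac{?(x+\delta)-?(x)}{\delta}$ as $\delta\to0$ (two-sided), and the value $+\infty$ is allowed (so "$?'(x)$ exists" means that the limit exists as a finite number or equals $+\infty$). For irrational $x\in(0,1)$ with regular continued fraction expansion $x=[0;a_1,a_2,\dots]$ (natural partial quotients), $S_x(t)=a_1+a_2+\dots+a_t$. Numerically $\kappa_1\approx1.388$, $\kappa_2\approx4.401$. *)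

theory Defs
  imports "HOL-Analysis.Analysis"
begin

section \<open>Farey fractions and the question mark function\<close>

text \<open>A fraction is kept as a pair (numerator, denominator) in lowest terms, because
  the mediant depends on the representation.\<close>

definition farey_seq :: "nat \<Rightarrow> (nat \<times> nat) set" where
  "farey_seq n = {(p, q). 1 \<le> q \<and> q \<le> n \<and> p \<le> q \<and> coprime p q}"

definition farey_consecutive :: "nat \<Rightarrow> nat \<Rightarrow> nat \<Rightarrow> nat \<Rightarrow> bool" where
  "farey_consecutive p q p' q' \<longleftrightarrow>
     (\<exists>n. (p, q) \<in> farey_seq n \<and> (p', q') \<in> farey_seq n \<and> real p / real q < real p' / real q' \<and>
          \<not> (\<exists>r s. (r, s) \<in> farey_seq n \<and>
                   real p / real q < real r / real s \<and> real r / real s < real p' / real q'))"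

text \<open>Membership in \<open>extensional {0..1}\<close> only fixes the irrelevant values outside the unit
  interval, so that the function is unique as a total function.\<close>

definition is_question_mark :: "(real \<Rightarrow> real) \<Rightarrow> bool" where
  "is_question_mark f \<longleftrightarrow>
     f \<in> extensional {0..1} \<and> continuous_on {0..1} f \<and> strict_mono_on {0..1} f \<and>
     f 0 = 0 \<and> f 1 = 1 \<and>
     (\<forall>p q p' q'. farey_consecutive p q p' q' \<longrightarrow>
        f (real (p + p') / real (q + q')) = (f (real p / real q) + f (real p' / real q')) / 2)"

definition question_mark :: "real \<Rightarrow> real" where
  "question_mark = (THE f. is_question_mark f)"

section \<open>Derivatives with possibly infinite values\<close>

definition has_extended_derivative :: "(real \<Rightarrow> real) \<Rightarrow> ereal \<Rightarrow> real \<Rightarrow> bool" where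
  "has_extended_derivative f L x \<longleftrightarrow>
     ((\<lambda>\<delta>. ereal ((f (x + \<delta>) - f x) / \<delta>)) \<longlongrightarrow> L) (at 0)"

section \<open>Partial quotients\<close>

text \<open>The Gauss map removes the first partial quotient; for irrational \<open>x\<close> in the open unit
  interval, \<open>partial_quotient x t\<close> is \<open>a\<^sub>t\<close> in \<open>x = [0; a\<^sub>1, a\<^sub>2, \<dots>]\<close>, for \<open>t \<ge> 1\<close>.\<close>

definition gauss_map :: "real \<Rightarrow> real" where
  "gauss_map y = frac (1 / y)"

definition partial_quotient :: "real \<Rightarrow> nat \<Rightarrow> nat" where
  "partial_quotient x t = nat \<lfloor>1 / (gauss_map ^^ (t - 1)) x\<rfloor>"

definition pq_sum :: "real \<Rightarrow> nat \<Rightarrow> nat" where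
  "pq_sum x t = (\<Sum>i = 1..t. partial_quotient x i)"

section \<open>The two constants\<close>

definition kappa1 :: real where
  "kappa1 = 2 * ln ((1 + sqrt 5) / 2) / ln 2"

definition kappa2 :: real where
  "kappa2 = (4 * ln ((5 + sqrt 29) / 2) - 5 * ln (2 + sqrt 5)) /
            (ln ((5 + sqrt 29) / 2) - ln (2 + sqrt 5) - ln (sqrt 2))"

section \<open>Existence and uniqueness of the question mark function\<close>

text \<open>Existence: \<open>qm_iter\<close> iterates the functional equations
  \<open>?(x) = ?(x / (1 - x)) / 2\<close> on \<open>[0, 1/2]\<close> and \<open>?(x) = 1 - ?((1 - x) / x) / 2\<close> on \<open>[1/2, 1]\<close>,
  which contract the supremum norm by a factor of 2. Uniqueness: every reduced fraction with
  denominator at least 2 is a mediant of consecutive Farey fractions.\<close>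

definition qmT :: "(real \<Rightarrow> real) \<Rightarrow> real \<Rightarrow> real" where
  "qmT f x = (if x \<le> 1/2 then f (x / (1 - x)) / 2 else 1 - f ((1 - x) / x) / 2)"

definition qm_iter :: "nat \<Rightarrow> real \<Rightarrow> real" where
  "qm_iter n = (qmT ^^ n) (\<lambda>x. x)"

lemma left_branch: "0 \<le> x \<Longrightarrow> x \<le> 1/2 \<Longrightarrow> x / (1 - x) \<in> {0..1::real}"
  by (auto simp: field_simps)

lemma right_branch: "1/2 \<le> x \<Longrightarrow> x \<le> 1 \<Longrightarrow> (1 - x) / x \<in> {0..1::real}"
  by (auto simp: field_simps)

lemma qm_iter_ends: "qm_iter n 0 = 0 \<and> qm_iter n 1 = 1"
  by (induction n) (auto simp: qm_iter_def qmT_def)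

lemma qm_iter_left: "x \<le> 1/2 \<Longrightarrow> qm_iter (Suc n) x = qm_iter n (x / (1 - x)) / 2"
  by (simp add: qm_iter_def qmT_def)

lemma qm_iter_right: "1/2 \<le> x \<Longrightarrow> qm_iter (Suc n) x = 1 - qm_iter n ((1 - x) / x) / 2"
proof (cases "x = 1/2")
  case True
  show ?thesis using qm_iter_left[of "1/2" n] qm_iter_ends[of n] unfolding True by simp
qed (simp add: qm_iter_def qmT_def)

lemma qm_iter_mono: "mono_on {0..1} (qm_iter n)"
proof (induction n)
  case 0
  show ?case by (auto simp: qm_iter_def mono_on_def)
next
  case (Suc n)
  have b: "0 \<le> qm_iter n z \<and> qm_iter n z \<le> 1" if "z \<in> {0..1}" for z
    using mono_onD[OF Suc.IH, of 0 z] mono_onD[OF Suc.IH, of z 1] qm_iter_ends[of n] that by auto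
  show ?case
  proof (rule mono_onI)
    fix x y :: real assume xy: "x \<in> {0..1}" "y \<in> {0..1}" "x \<le> y"
    consider "y \<le> 1/2" | "1/2 \<le> x" | "x \<le> 1/2" "1/2 \<le> y" by linarith
    then show "qm_iter (Suc n) x \<le> qm_iter (Suc n) y"
    proof cases
      case 1
      have "x / (1 - x) \<le> y / (1 - y)" using xy 1 by (simp add: field_simps)
      then have "qm_iter n (x / (1 - x)) \<le> qm_iter n (y / (1 - y))"
        using mono_onD[OF Suc.IH left_branch left_branch] xy 1 by auto
      then show ?thesis using 1 xy by (simp add: qm_iter_left)
    next
      case 2
      have "(1 - y) / y \<le> (1 - x) / x" using xy 2 by (simp add: field_simps)
      then have "qm_iter n ((1 - y) / y) \<le> qm_iter n ((1 - x) / x)"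
        using mono_onD[OF Suc.IH right_branch right_branch] xy 2 by auto
      then show ?thesis using 2 xy by (simp add: qm_iter_right)
    next
      case 3
      show ?thesis
        using b[OF left_branch[of x]] b[OF right_branch[of y]] xy 3
        by (simp add: qm_iter_left qm_iter_right)
    qed
  qed
qed

lemma qm_iter_cont: "continuous_on {0..1} (qm_iter n)"
proof (induction n)
  case 0
  show ?case by (simp add: qm_iter_def)
next
  case (Suc n)
  have l: "continuous_on {0..1/2} (qm_iter (Suc n))"
  proof (rule continuous_on_eq)
    show "continuous_on {0..1/2} (\<lambda>x. qm_iter n (x / (1 - x)) / 2)"
      by (rule continuous_on_divide continuous_on_compose2[OF Suc.IH] continuous_intros)+
         (use left_branch in auto)
  qed (simp add: qm_iter_left)
  have r: "continuous_on {1/2..1} (qm_iter (Suc n))"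
  proof (rule continuous_on_eq)
    have "continuous_on {1/2..1::real} (\<lambda>x. (1 - x) / x)"
      by (intro continuous_intros) auto
    then have "continuous_on {1/2..1} (\<lambda>x. qm_iter n ((1 - x) / x))"
      by (rule continuous_on_compose2[OF Suc.IH]) (use right_branch in auto)
    then show "continuous_on {1/2..1} (\<lambda>x. 1 - qm_iter n ((1 - x) / x) / 2)"
      by (intro continuous_intros) auto
  qed (simp add: qm_iter_right)
  have "continuous_on ({0..1/2} \<union> {1/2..1}) (qm_iter (Suc n))"
    by (rule continuous_on_closed_Un[OF _ _ l r]) auto
  also have "{0..1/2} \<union> {1/2..1} = {0..1::real}" by auto
  finally show ?case .
qed

lemma qm_iter_diff: "x \<in> {0..1} \<Longrightarrow> \<bar>qm_iter (Suc n) x - qm_iter n x\<bar> \<le> (1/2)^n"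
proof (induction n arbitrary: x)
  case 0
  have "0 \<le> qm_iter 1 x" "qm_iter 1 x \<le> 1"
    using mono_onD[OF qm_iter_mono, of 0 x 1] mono_onD[OF qm_iter_mono, of x 1 1] 0
      qm_iter_ends[of 1] by auto
  moreover have "qm_iter 0 x = x" by (simp add: qm_iter_def)
  ultimately show ?case using 0 by (simp add: abs_le_iff)
next
  case (Suc n)
  show ?case
  proof (cases "x \<le> 1/2")
    case True
    show ?thesis using Suc.IH[OF left_branch[of x]] Suc.prems True
      by (simp add: qm_iter_left flip: diff_divide_distrib)
  next
    case False
    show ?thesis using Suc.IH[OF right_branch[of x]] Suc.prems False
      by (simp add: qm_iter_right abs_minus_commute flip: diff_divide_distrib)
  qed
qed

lemma qm_limit_exists:
  obtains f :: "real \<Rightarrow> real" where "continuous_on {0..1} f" "mono_on {0..1} f" "f 0 = 0" "f 1 = 1"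
    "\<And>x. 0 \<le> x \<Longrightarrow> x \<le> 1/2 \<Longrightarrow> f x = f (x / (1 - x)) / 2"
    "\<And>x. 1/2 \<le> x \<Longrightarrow> x \<le> 1 \<Longrightarrow> f x = 1 - f ((1 - x) / x) / (2::real)"
proof -
  define d where "d = (\<lambda>n x. qm_iter (Suc n) x - qm_iter n x)"
  define f where "f = (\<lambda>x::real. x + (\<Sum>n. d n x))"
  have "uniform_limit {0..1} (\<lambda>n x. \<Sum>i<n. d i x) (\<lambda>x. suminf (\<lambda>i. d i x)) sequentially"
    by (rule Weierstrass_m_test[where M = "\<lambda>n. (1/2)^n"])
       (use qm_iter_diff in \<open>auto simp: d_def\<close>)
  then have "uniform_limit {0..1} (\<lambda>n x. x + (\<Sum>i<n. d i x)) f sequentially"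
    unfolding f_def by (intro uniform_limit_intros)
  moreover have "(\<lambda>n x. x + (\<Sum>i<n. d i x)) = qm_iter"
  proof (intro ext)
    fix n x show "x + (\<Sum>i<n. d i x) = qm_iter n x"
      unfolding d_def sum_lessThan_telescope[where f = "\<lambda>k. qm_iter k x"]
      by (simp add: qm_iter_def[of 0])
  qed
  ultimately have u: "uniform_limit {0..1} qm_iter f sequentially" by simp
  have lim: "(\<lambda>n. qm_iter n x) \<longlonglongrightarrow> f x" if "x \<in> {0..1}" for x
    using tendsto_uniform_limitI[OF u that] .
  show thesis
  proof
    show "continuous_on {0..1} f"
      by (rule uniform_limit_theorem[OF _ u]) (auto simp: qm_iter_cont)
    show "mono_on {0..1} f"
    proof (rule mono_onI)
      fix x y :: real assume "x \<in> {0..1}" "y \<in> {0..1}" "x \<le> y"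
      then show "f x \<le> f y"
        using LIMSEQ_le[OF lim[of x] lim[of y]] mono_onD[OF qm_iter_mono] by blast
    qed
    show "f 0 = 0" using LIMSEQ_unique[OF lim[of 0]] qm_iter_ends by simp
    show "f 1 = 1" using LIMSEQ_unique[OF lim[of 1]] qm_iter_ends by simp
    show "f x = f (x / (1 - x)) / 2" if x: "0 \<le> x" "x \<le> 1/2" for x
    proof (rule LIMSEQ_unique)
      show "(\<lambda>n. qm_iter (Suc n) x) \<longlonglongrightarrow> f x" using lim[of x] x by (intro LIMSEQ_Suc) auto
      show "(\<lambda>n. qm_iter (Suc n) x) \<longlonglongrightarrow> f (x / (1 - x)) / 2"
        unfolding qm_iter_left[OF x(2)] by (intro tendsto_intros lim left_branch x) auto
    qed
    show "f x = 1 - f ((1 - x) / x) / 2" if x: "1/2 \<le> x" "x \<le> 1" for x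
    proof (rule LIMSEQ_unique)
      show "(\<lambda>n. qm_iter (Suc n) x) \<longlonglongrightarrow> f x" using lim[of x] x by (intro LIMSEQ_Suc) auto
      show "(\<lambda>n. qm_iter (Suc n) x) \<longlonglongrightarrow> 1 - f ((1 - x) / x) / 2"
        unfolding qm_iter_right[OF x(1)] by (intro tendsto_intros lim right_branch x) auto
    qed
  qed
qed

lemma consecutive_det:
  assumes "farey_consecutive p q p' q'"
  shows "int p' * int q - int p * int q' = 1"
proof -
  obtain n where n: "1 \<le> q" "q \<le> n" "p \<le> q" "coprime p q" "1 \<le> q'" "q' \<le> n" "p' \<le> q'" "coprime p' q'"
    and lt: "real p / real q < real p' / real q'"
    and nb: "\<And>r s. (r, s) \<in> farey_seq n \<Longrightarrow> real p / real q < real r / real s \<Longrightarrow>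
        real r / real s < real p' / real q' \<Longrightarrow> False"
    using assms unfolding farey_consecutive_def by (auto simp: farey_seq_def)
  have "real p * real q' < real p' * real q" using lt n by (simp add: field_simps)
  then have lti: "int p * int q' < int p' * int q"
    by (metis of_nat_less_iff of_nat_mult)
  have pq: "p < q"
  proof (rule ccontr)
    assume "\<not> p < q"
    then have "p = q" using n by simp
    then have "int q * int q' < int p' * int q" using lti by simp
    then have "int q' < int p'" using n by (simp add: mult.commute)
    then show False using n by simp
  qed
  obtain x y where xy: "x * int q + y * int p = 1"
    using bezout_int[of "int q" "int p"] n by (metis coprime_commute coprime_iff_gcd_eq_1 coprime_int_iff)
  \<comment> \<open>v is congruent to -y modulo q and lies in (n - q, n]\<close>
  define v where "v = int n - ((int n + y) mod int q)"
  have m: "0 \<le> (int n + y) mod int q" "(int n + y) mod int q < int q" using n by auto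
  have v: "int n - int q < v" "v \<le> int n" "v > 0 \<or> v = 0" using m n unfolding v_def by linarith+
  have "v = - y + int q * ((int n + y) div int q)"
    unfolding v_def using mult_div_mod_eq[of "int q" "int n + y"] by linarith
  then obtain k where k: "v = - y + int q * k" by blast
  define u where "u = x + int p * k"
  have uv: "u * int q - int p * v = 1" unfolding u_def k using xy by (simp add: algebra_simps)
  have v0: "v \<noteq> 0"
  proof
    assume "v = 0"
    then have "u * int q = 1" using uv by simp
    then have "q = 1" using n by (simp add: zmult_eq_1_iff)
    then show False using v n \<open>v = 0\<close> by simp
  qed
  have vp: "v > 0" using v v0 by simp
  have up: "u > 0"
  proof -
    have "u * int q > 0" using uv vp by (smt (verit) mult_nonneg_nonneg of_nat_0_le_iff)
    then show ?thesis using n by (simp add: zero_less_mult_iff)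
  qed
  have uv_le: "u \<le> v"
  proof (rule ccontr)
    assume "\<not> u \<le> v"
    then have "(v + 1) * int q \<le> u * int q" by (intro mult_right_mono) auto
    moreover have "int p * v \<le> (int q - 1) * v" using pq vp by (intro mult_right_mono) auto
    ultimately have "int q + v \<le> 1" using uv by (simp add: algebra_simps)
    then show False using vp n by simp
  qed
  have cop: "coprime u v"
    using uv by (metis coprimeI dvd_diff dvd_mult dvd_mult2)
  define r s where "r = nat u" and "s = nat v"
  have rs: "int r = u" "int s = v" using up vp by (auto simp: r_def s_def)
  have mem: "(r, s) \<in> farey_seq n"
    using rs vp v uv_le cop unfolding farey_seq_def
    by (auto simp flip: coprime_int_iff)
  have uv': "int r * int q - int p * int s = 1" using uv rs by simp
  have s0: "s > 0" using rs vp by simp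
  have lt1: "real p / real q < real r / real s"
  proof -
    have "int p * int s < int r * int q" using uv' by simp
    then have "real p * real s < real r * real q" by (metis of_nat_less_iff of_nat_mult)
    then show ?thesis using s0 n by (simp add: field_simps)
  qed
  have "\<not> real r / real s < real p' / real q'" using nb[OF mem lt1] by blast
  then have "real p' * real s \<le> real r * real q'" using s0 n by (simp add: field_simps)
  then have le: "int p' * int s \<le> int r * int q'" by (metis of_nat_le_iff of_nat_mult)
  show ?thesis
  proof (cases "int p' * int s = int r * int q'")
    case True
    then have e: "p' * s = r * q'" by (metis of_nat_eq_iff of_nat_mult)
    have "coprime r s" using mem by (auto simp: farey_seq_def)
    then have "p' = r \<and> s = q'" using e n(8)
      by (metis coprime_crossproduct_nat mult.commute)
    then show ?thesis using uv' by simp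
  next
    case False
    then have A: "int r * int q' - int p' * int s \<ge> 1" using le by simp
    have B: "int p' * int q - int p * int q' \<ge> 1" using lti by simp
    have "int q' = int q' * (int r * int q - int p * int s)" using uv' by simp
    also have "\<dots> = int q * (int r * int q' - int p' * int s) + int s * (int p' * int q - int p * int q')"
      by (simp add: algebra_simps)
    also have "\<dots> \<ge> int q * 1 + int s * 1" by (intro add_mono mult_left_mono A B) auto
    finally have "int q' \<ge> int q + int s" by simp
    then show ?thesis using rs v n by simp
  qed
qed

lemma det_consecutive:
  assumes "int p' * int q - int p * int q' = 1" "1 \<le> q" "1 \<le> q'" "p \<le> q" "p' \<le> q'"
  shows "farey_consecutive p q p' q'"
proof -
  have "coprime (int p) (int q)" "coprime (int p') (int q')"
    using assms(1) by (metis coprimeI dvd_diff dvd_mult dvd_mult2)+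
  then have c: "coprime p q" "coprime p' q'" by simp_all
  have cross: "(real a / real b < real c / real d) = (int a * int d < int c * int b)"
    if "b \<ge> 1" "d \<ge> 1" for a b c d
  proof -
    have "(real a / real b < real c / real d) = (real (a * d) < real (c * b))"
      using that by (simp add: field_simps)
    also have "\<dots> = (int a * int d < int c * int b)" by (metis of_nat_less_iff of_nat_mult)
    finally show ?thesis .
  qed
  have "False" if rs: "(r, s) \<in> farey_seq (max q q')" and a: "real p / real q < real r / real s"
    and b: "real r / real s < real p' / real q'" for r s
  proof -
    have s: "1 \<le> s" "s \<le> max q q'" using rs by (auto simp: farey_seq_def)
    have A: "int r * int q - int p * int s \<ge> 1" using a cross[OF assms(2) s(1)] by simp
    have B: "int p' * int s - int r * int q' \<ge> 1" using b cross[OF s(1) assms(3)] by simp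
    have "int s = int s * (int p' * int q - int p * int q')" using assms(1) by simp
    also have "\<dots> = int q' * (int r * int q - int p * int s) + int q * (int p' * int s - int r * int q')"
      by (simp add: algebra_simps)
    also have "\<dots> \<ge> int q' * 1 + int q * 1" by (intro add_mono mult_left_mono A B) auto
    finally show False using s assms by simp
  qed
  moreover have "real p / real q < real p' / real q'" using cross[OF assms(2,3)] assms(1) by simp
  ultimately show ?thesis unfolding farey_consecutive_def
    by (intro exI[of _ "max q q'"]) (use assms c in \<open>auto simp: farey_seq_def\<close>)
qed

lemma mediant_parents:
  assumes "coprime r s" "2 \<le> s" "r \<le> s"
  obtains p q p' q' where "farey_consecutive p q p' q'" "r = p + p'" "s = q + q'" "q < s" "q' < s"
    "p \<le> q" "p' \<le> q'" "1 \<le> q" "1 \<le> q'"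
proof -
  have "r \<noteq> s" using assms by (metis coprime_self One_nat_def not_less_eq_eq numeral_2_eq_2 nat_dvd_1_iff_1 is_unit_gcd order_refl)
  then have rs: "r < s" using assms by simp
  have r0: "r > 0" using assms by (cases r) auto
  obtain x y where xy: "x * int s + y * int r = 1"
    using bezout_int[of "int s" "int r"] assms by (metis coprime_commute coprime_iff_gcd_eq_1 coprime_int_iff)
  define q where "q = y mod int s"
  define p where "p = - x - int r * (y div int s)"
  have det: "int r * q - p * int s = 1"
  proof -
    have q': "q = y - int s * (y div int s)" unfolding q_def by (simp add: minus_mult_div_eq_mod)
    show ?thesis unfolding p_def q' using xy by (simp add: algebra_simps)
  qed
  have q: "0 \<le> q" "q < int s" unfolding q_def using assms by auto
  have q0: "q \<noteq> 0"
  proof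
    assume "q = 0"
    then have "int s dvd 1" using det by (metis dvd_triv_right dvd_minus_iff diff_0 mult_zero_right)
    then show False using assms by simp
  qed
  then have q1: "q \<ge> 1" using q by simp
  have p0: "p \<ge> 0"
  proof (rule ccontr)
    assume "\<not> p \<ge> 0"
    then have "p * int s \<le> (-1) * int s" by (intro mult_right_mono) auto
    moreover have "int r * q \<ge> 0" using q by simp
    ultimately show False using det assms by simp
  qed
  have pq: "p < q"
  proof (rule ccontr)
    assume "\<not> p < q"
    then have "q * int s \<le> p * int s" by (intro mult_right_mono) auto
    moreover have "int r * q \<le> int s * q" using rs q by (intro mult_right_mono) auto
    ultimately show False using det by (simp add: mult.commute)
  qed
  have pr: "p \<le> int r"
  proof (rule ccontr)
    assume "\<not> p \<le> int r"
    then have "int r * int s \<le> p * int s" by (intro mult_right_mono) auto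
    moreover have "int r * q \<le> int r * int s" using q by (intro mult_left_mono) auto
    ultimately show False using det by simp
  qed
  have pq': "int r - p \<le> int s - q"
  proof (rule ccontr)
    assume "\<not> int r - p \<le> int s - q"
    then have "int r - p \<ge> int s - q + 1" by simp
    then have "q - p \<ge> int s - int r + 1" by simp
    then have "(int s - int r + 1) * int s \<le> (q - p) * int s" by (intro mult_right_mono) auto
    moreover have "(int s - int r) * q \<le> (int s - int r) * int s" using q rs by (intro mult_left_mono) auto
    moreover have "(q - p) * int s - (int s - int r) * q = 1" using det by (simp add: algebra_simps)
    ultimately have "int s \<le> 1" by (simp add: algebra_simps)
    then show False using assms by simp
  qed
  define P Q P' Q' where "P = nat p" and "Q = nat q" and "P' = nat (int r - p)" and "Q' = nat (int s - q)"
  have i: "int P = p" "int Q = q" "int P' = int r - p" "int Q' = int s - q"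
    using p0 q pr by (auto simp: P_def Q_def P'_def Q'_def)
  have "farey_consecutive P Q P' Q'"
  proof (rule det_consecutive)
    show "int P' * int Q - int P * int Q' = 1" unfolding i using det by (simp add: algebra_simps)
  qed (use i pq pq' q1 q in linarith)+
  moreover have "r = P + P'" "s = Q + Q'" "Q < s" "Q' < s" "P \<le> Q" "P' \<le> Q'" "1 \<le> Q" "1 \<le> Q'"
    using i q1 q pq pq' by linarith+
  ultimately show thesis using that by blast
qed

lemma question_mark_unique:
  assumes f: "is_question_mark f" and g: "is_question_mark g"
  shows "f = g"
proof -
  have rat: "f (real r / real s) = g (real r / real s)" if "coprime r s" "1 \<le> s" "r \<le> s" for r s
    using that
  proof (induction s arbitrary: r rule: less_induct)
    case (less s)
    show ?case
    proof (cases "s = 1")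
      case True
      then have "r = 0 \<or> r = 1" using less.prems by auto
      then show ?thesis using True f g by (auto simp: is_question_mark_def)
    next
      case False
      then have "2 \<le> s" using less.prems by simp
      then obtain p q p' q' where h: "farey_consecutive p q p' q'" "r = p + p'" "s = q + q'" "q < s" "q' < s"
        "p \<le> q" "p' \<le> q'" "1 \<le> q" "1 \<le> q'"
        using mediant_parents less.prems by metis
      have c: "coprime p q" "coprime p' q'" using h(1) by (auto simp: farey_consecutive_def farey_seq_def)
      have "f (real p / real q) = g (real p / real q)" "f (real p' / real q') = g (real p' / real q')"
        using less.IH[of q p] less.IH[of q' p'] h c by auto
      then show ?thesis using f g h(1) unfolding h(2,3) is_question_mark_def by metis
    qed
  qed
  have ratQ: "f z = g z" if z: "z \<in> \<rat>" "z \<in> {0..1}" for z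
  proof -
    obtain m n where mn: "n \<noteq> 0" "\<bar>z\<bar> = real m / real n" "coprime m n"
      using Rats_abs_nat_div_natE[OF z(1)] by metis
    have "z = real m / real n" using mn z by simp
    moreover from this have "real m \<le> real n" using z mn by (simp add: divide_le_eq)
    ultimately show ?thesis using rat[of m n] mn by simp
  qed
  have on: "f x = g x" if x: "x \<in> {0..1}" for x
  proof -
    have cf: "continuous_on {0..1} f" and cg: "continuous_on {0..1} g"
      using f g by (auto simp: is_question_mark_def)
    have cl: "closed {y \<in> {0..1}. f y - g y = 0}"
      using continuous_closed_preimage_constant[of "{0..1}" "\<lambda>y. f y - g y" 0] cf cg
      by (auto intro!: continuous_intros)
    have "x \<in> closure (\<rat> \<inter> {0..1})"
    proof (subst closure_approachable, intro allI impI)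
      fix e :: real assume e: "e > 0"
      consider "x < 1" | "x = 1" using x by fastforce
      then show "\<exists>y\<in>\<rat> \<inter> {0..1}. dist y x < e"
      proof cases
        case 1
        then obtain y where "y \<in> \<rat>" "x < y" "y < min 1 (x + e)"
          using Rats_dense_in_real[of x "min 1 (x + e)"] e by auto
        then show ?thesis using x by (intro bexI[of _ y]) (auto simp: dist_real_def)
      next
        case 2
        then show ?thesis using e by (intro bexI[of _ 1]) auto
      qed
    qed
    also have "\<dots> \<subseteq> {y \<in> {0..1}. f y - g y = 0}"
      by (rule closure_minimal[OF _ cl]) (use ratQ in auto)
    finally show ?thesis by simp
  qed
  show ?thesis
    by (rule extensionalityI[of f "{0..1}" g]) (use f g on in \<open>auto simp: is_question_mark_def\<close>)
qed

lemma cross_sub_less: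
  fixes p q p' q' :: nat
  assumes "p \<le> q" "p' \<le> q'" "p * q' < p' * q"
  shows "p * (q' - p') < p' * (q - p)"
proof -
  obtain a b where "q = p + a" "q' = p' + b" using assms by (auto dest!: le_Suc_ex)
  then show ?thesis using assms(3) by (simp add: algebra_simps)
qed

lemma cross_sub_det:
  fixes p q p' q' :: nat
  assumes "p \<le> q" "p' \<le> q'" "p' * q = p * q' + 1"
  shows "p' * (q - p) = p * (q' - p') + 1"
proof -
  obtain a b where "q = p + a" "q' = p' + b" using assms by (auto dest!: le_Suc_ex)
  then show ?thesis using assms(3) by (simp add: algebra_simps)
qed

lemma question_mark_exists: "\<exists>f. is_question_mark f"
proof -
  obtain f :: "real \<Rightarrow> real" where cont: "continuous_on {0..1} f" and mono: "mono_on {0..1} f"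
    and f0: "f 0 = 0" and f1: "f 1 = 1"
    and L: "\<And>x. 0 \<le> x \<Longrightarrow> x \<le> 1/2 \<Longrightarrow> f x = f (x / (1 - x)) / 2"
    and R: "\<And>x. 1/2 \<le> x \<Longrightarrow> x \<le> 1 \<Longrightarrow> f x = 1 - f ((1 - x) / x) / (2::real)"
    using qm_limit_exists by metis
  have Lq: "f (real p / real q) = f (real p / real (q - p)) / 2" if "2 * p \<le> q" "1 \<le> q" for p q
  proof -
    have "real (2 * p) \<le> real q" using that(1) by (rule of_nat_mono)
    then have "real p / real q \<le> 1/2" using that by (simp add: field_simps)
    moreover have "(real p / real q) / (1 - real p / real q) = real p / real (q - p)"
    proof -
      have "1 - real p / real q = real (q - p) / real q"
        using that by (simp add: diff_divide_distrib of_nat_diff)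
      then show ?thesis using that by simp
    qed
    ultimately show ?thesis using L[of "real p / real q"] by (metis divide_nonneg_nonneg of_nat_0_le_iff)
  qed
  have Rq: "f (real p / real q) = 1 - f (real (q - p) / real p) / 2" if "q \<le> 2 * p" "p \<le> q" "1 \<le> q" for p q
  proof -
    have "real q \<le> real (2 * p)" using that(1) by (rule of_nat_mono)
    then have "1/2 \<le> real p / real q" "real p / real q \<le> 1" using that by (simp_all add: field_simps)
    moreover have "(1 - real p / real q) / (real p / real q) = real (q - p) / real p"
    proof -
      have "1 - real p / real q = real (q - p) / real q"
        using that by (simp add: diff_divide_distrib of_nat_diff)
      then show ?thesis using that by simp
    qed
    ultimately show ?thesis using R[of "real p / real q"] by metis
  qed
  have half: "f (1/2) = 1/2" using L[of "1/2"] f1 by simp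
  have strict_rat: "f (real p / real q) < f (real p' / real q')"
    if "p * q' < p' * q" "1 \<le> q" "1 \<le> q'" "p' \<le> q'" for p q p' q'
    using that
  proof (induction "q + q'" arbitrary: p q p' q' rule: less_induct)
    case less
    have p': "p' \<ge> 1" using less.prems by (cases p') auto
    have pq: "p < q"
    proof (rule ccontr)
      assume "\<not> p < q"
      then have "q * p' \<le> p * q'" using less.prems by (intro mult_mono) auto
      then show False using less.prems by (simp add: mult.commute)
    qed
    consider "2 * p' \<le> q'" | "q \<le> 2 * p" | "2 * p < q" "q' < 2 * p'" by linarith
    then show ?case
    proof cases
      case 1
      have "2 * p \<le> q"
      proof (rule ccontr)
        assume "\<not> 2 * p \<le> q"
        then have "q * (2 * p') \<le> (2 * p) * q'" using 1 by (intro mult_mono) auto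
        then show False using less.prems by (simp add: mult.commute)
      qed
      moreover have "p * (q' - p') < p' * (q - p)"
        using cross_sub_less less.prems pq by simp
      ultimately have "f (real p / real (q - p)) < f (real p' / real (q' - p'))"
        using 1 less.prems p' pq by (intro less.hyps) auto
      then show ?thesis using Lq[of p q] Lq[of p' q'] 1 \<open>2 * p \<le> q\<close> less.prems by simp
    next
      case 2
      have 3: "q' \<le> 2 * p'"
      proof (rule ccontr)
        assume "\<not> q' \<le> 2 * p'"
        then have "(2 * p') * q \<le> q' * (2 * p)" using 2 by (intro mult_mono) auto
        then show False using less.prems by (simp add: mult.commute)
      qed
      have "(q' - p') * p < (q - p) * p'"
        using cross_sub_less[of p q p' q'] less.prems pq by (simp add: mult.commute)
      then have "f (real (q' - p') / real p') < f (real (q - p) / real p)"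
        using 2 less.prems p' pq by (intro less.hyps) auto
      then show ?thesis using Rq[of q p] Rq[of q' p'] 2 3 pq less.prems by simp
    next
      case 3
      have "f (real p / real q) < 1/2"
      proof (cases "p = 0")
        case True then show ?thesis using f0 by simp
      next
        case False
        have "f (real p / real (q - p)) < f (real 1 / real 1)"
          using False 3 less.prems pq by (intro less.hyps) auto
        then show ?thesis using Lq[of p q] 3 less.prems f1 by simp
      qed
      also have "1/2 \<le> f (real p' / real q')"
      proof -
        have "1/2 \<le> real p' / real q'" "real p' / real q' \<le> 1" using 3 less.prems by (simp_all add: field_simps)
        then show ?thesis using mono_onD[OF mono, of "1/2" "real p' / real q'"] half by simp
      qed
      finally show ?thesis .
    qed
  qed
  have strict: "strict_mono_on {0..1} f"
  proof (rule strict_mono_onI)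
    fix x y :: real assume xy: "x \<in> {0..1}" "y \<in> {0..1}" "x < y"
    obtain a where a: "a \<in> \<rat>" "x < a" "a < y" using Rats_dense_in_real xy by blast
    obtain b where b: "b \<in> \<rat>" "a < b" "b < y" using Rats_dense_in_real a by blast
    obtain p q where p: "q \<noteq> 0" "\<bar>a\<bar> = real p / real q" using Rats_abs_nat_div_natE[OF a(1)] by metis
    obtain p' q' where p': "q' \<noteq> 0" "\<bar>b\<bar> = real p' / real q'" using Rats_abs_nat_div_natE[OF b(1)] by metis
    have ab: "a = real p / real q" "b = real p' / real q'" using p p' a b xy by auto
    have "real (p * q') < real (p' * q)" using b(2) p(1) p'(1) unfolding ab by (simp add: field_simps)
    moreover have "p' \<le> q'"
    proof -
      have "b \<le> 1" using b xy by simp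
      then show ?thesis using p'(1) unfolding ab by (simp add: divide_le_eq)
    qed
    ultimately have "f a < f b" unfolding ab using p p' by (intro strict_rat) (auto simp del: of_nat_mult)
    moreover have "f x \<le> f a" "f b \<le> f y" using mono_onD[OF mono] a b xy by auto
    ultimately show "f x < f y" by linarith
  qed
  have med: "f (real (p + p') / real (q + q')) = (f (real p / real q) + f (real p' / real q')) / 2"
    if "p' * q = p * q' + 1" "1 \<le> q" "1 \<le> q'" "p \<le> q" "p' \<le> q'" for p q p' q'
    using that
  proof (induction "q + q'" arbitrary: p q p' q' rule: less_induct)
    case less
    have p': "p' \<ge> 1" using less.prems by (cases p') auto
    have pq: "p < q"
    proof (rule ccontr)
      assume "\<not> p < q"
      then have "q * p' \<le> p * q'" using less.prems by (intro mult_mono) auto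
      then show False using less.prems by (simp add: mult.commute)
    qed
    consider "2 * p' \<le> q'" | "q \<le> 2 * p" | "2 * p < q" "q' < 2 * p'" by linarith
    then show ?case
    proof cases
      case 1
      have pq2: "2 * p \<le> q"
      proof (rule ccontr)
        assume "\<not> 2 * p \<le> q"
        then have "q * (2 * p') \<le> (2 * p) * q'" using 1 by (intro mult_mono) auto
        then show False using less.prems by (simp add: mult.commute)
      qed
      have "p' * (q - p) = p * (q' - p') + 1"
        using cross_sub_det less.prems pq by simp
      then have "f (real (p + p') / real ((q - p) + (q' - p'))) =
          (f (real p / real (q - p)) + f (real p' / real (q' - p'))) / 2"
        using 1 pq2 less.prems p' pq by (intro less.hyps) auto
      moreover have "(q - p) + (q' - p') = (q + q') - (p + p')" using 1 pq by simp
      ultimately show ?thesis using Lq[of p q] Lq[of p' q'] Lq[of "p + p'" "q + q'"] 1 pq2 less.prems by simp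
    next
      case 2
      have 3: "q' \<le> 2 * p'"
      proof (rule ccontr)
        assume "\<not> q' \<le> 2 * p'"
        then have "(2 * p') * q \<le> q' * (2 * p)" using 2 by (intro mult_mono) auto
        then show False using less.prems by (simp add: mult.commute)
      qed
      have "(q - p) * p' = (q' - p') * p + 1"
        using cross_sub_det[of p q p' q'] less.prems pq by (simp add: mult.commute)
      then have "f (real ((q' - p') + (q - p)) / real (p' + p)) =
          (f (real (q' - p') / real p') + f (real (q - p) / real p)) / 2"
        using 2 3 less.prems p' pq by (intro less.hyps) auto
      moreover have "(q' - p') + (q - p) = (q + q') - (p + p')" using less.prems by simp
      ultimately show ?thesis
        using Rq[of q p] Rq[of q' p'] Rq[of "q + q'" "p + p'"] 2 3 pq less.prems
        by (simp add: add.commute add_divide_distrib)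
    next
      case 3
      have "(2 * p + 1) * q' \<le> q * q'" using 3 by (intro mult_right_mono) auto
      moreover have "q * (q' + 1) \<le> q * (2 * p')" using 3 by (intro mult_left_mono) auto
      ultimately have "q + q' \<le> 2" using less.prems(1) by (simp add: algebra_simps)
      then have "q = 1" "q' = 1" using less.prems by auto
      moreover from this have "p = 0" "p' = 1" using pq p' less.prems by auto
      ultimately show ?thesis using f0 f1 half by simp
    qed
  qed
  define g where "g = restrict f {0..1}"
  have gf: "g x = f x" if "x \<in> {0..1}" for x using that by (simp add: g_def)
  have "is_question_mark g"
    unfolding is_question_mark_def
  proof (intro conjI allI impI)
    show "g \<in> extensional {0..1}" by (simp add: g_def)
    show "continuous_on {0..1} g" using cont continuous_on_eq gf by metis
    show "strict_mono_on {0..1} g" using strict by (auto simp: strict_mono_on_def gf)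
    show "g 0 = 0" "g 1 = 1" using f0 f1 by (auto simp: gf)
    fix p q p' q' assume c: "farey_consecutive p q p' q'"
    have r: "1 \<le> q" "1 \<le> q'" "p \<le> q" "p' \<le> q'" using c by (auto simp: farey_consecutive_def farey_seq_def)
    have "int (p' * q) = int (p * q' + 1)" using consecutive_det[OF c] by simp
    then have "p' * q = p * q' + 1" by linarith
    then have "f (real (p + p') / real (q + q')) = (f (real p / real q) + f (real p' / real q')) / 2"
      using med r by blast
    moreover have "real p / real q \<in> {0..1}" "real p' / real q' \<in> {0..1}"
      "real (p + p') / real (q + q') \<in> {0..1}" using r by (auto simp: field_simps)
    ultimately show "g (real (p + p') / real (q + q')) = (g (real p / real q) + g (real p' / real q')) / 2"
      by (simp only: gf)
  qed
  then show ?thesis by blast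
qed

lemma is_question_mark_question_mark: "is_question_mark question_mark"
  unfolding question_mark_def
  using question_mark_exists question_mark_unique by (metis theI)

end

theory Submission
  imports Defs "HOL-Real_Asymp.Real_Asymp" "HOL-Library.Discrete_Functions"
begin

text \<open>At depth \<open>n\<close> of the Stern--Brocot tree, \<open>?\<close> maps an interval of length \<open>1 / (q q')\<close> onto one of
  length about \<open>2\<^sup>-\<^sup>n\<close>. If \<open>y\<close> leaves the path of \<open>x\<close> at depth \<open>n\<close>, the mediant separates \<open>x\<close> from
  \<open>y\<close>, and the difference quotient is bounded above by \<open>(q + q')\<^sup>2 / 2\<^sup>n\<close> and below by
  \<open>q q' / 2\<^sup>N\<close>, where \<open>N\<close> is a depth at which the mediant is no longer an endpoint. In terms of
  convergents, \<open>?'(x) = 0\<close> as soon as \<open>q\<^sub>t\<^sup>2 / 2 ^ S\<^sub>x(t) \<longlongrightarrow> 0\<close>, and \<open>?'(x) = \<infinity>\<close> as soon as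
  \<open>q\<^sub>t q\<^sub>t\<^sub>-\<^sub>1 / 2 ^ S\<^sub>x(t + 2) \<longlongrightarrow> \<infinity>\<close>.

  For \<open>\<kappa>\<^sub>1\<close> one compares \<open>q\<^sub>t\<close> with powers of the golden ratio; it is attained by partial quotients 1
  with sparse large exceptions at the squares. For \<open>\<kappa>\<^sub>2\<close> a potential function shows that \<open>q\<^sub>t\<close> is
  at most a constant times \<open>\<lambda>\<^sub>4 ^ t (\<lambda>\<^sub>5 / \<lambda>\<^sub>4) ^ (S\<^sub>x(t) - 4 t)\<close>, where \<open>\<lambda>\<^sub>s = [s; s, s, \<dots>]\<close>; long blocks of
  fives and fours lose only a constant factor per block. In both examples \<open>S\<^sub>x(t)\<close> deviates from
  \<open>\<kappa> t\<close> by about \<open>t\<^bsup>3/4\<^esup>\<close>, which is \<open>o(t)\<close> but beats the \<open>O(\<surd>t log t)\<close> loss of the exceptions.\<close>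

section \<open>The Stern--Brocot path of a point\<close>

text \<open>Starting from the pair for 1/0 instead of 1/1 makes the first run of equal steps have
  length a_1 exactly. The price is a shift by one: for x in (0,1) the interval at depth
  \<open>Suc n\<close> has \<open>?\<close>-length 2^-n.\<close>

fun sb :: "real \<Rightarrow> nat \<Rightarrow> (nat \<times> nat) \<times> (nat \<times> nat)" where
  "sb x 0 = ((0, 1), (1, 0))"
| "sb x (Suc n) = (case sb x n of ((p, q), (p', q')) \<Rightarrow>
     if real (q + q') * x < real (p + p') then ((p, q), (p + p', q + q'))
     else ((p + p', q + q'), (p', q')))"

section \<open>The function \<open>?\<close> along Farey chains and across a mediant\<close>

lemma question_mark_0 [simp]: "question_mark 0 = 0"
  and question_mark_1 [simp]: "question_mark 1 = 1"
  and question_mark_strict_mono: "strict_mono_on {0..1} question_mark"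
  using is_question_mark_question_mark by (auto simp: is_question_mark_def)

lemma question_mark_mono: "0 \<le> u \<Longrightarrow> u \<le> v \<Longrightarrow> v \<le> 1 \<Longrightarrow> question_mark u \<le> question_mark v"
  using strict_mono_on_leD[OF question_mark_strict_mono, of u v] by simp

lemma question_mark_mediant:
  assumes "p' * q = p * q' + 1" "1 \<le> q" "1 \<le> q'" "p \<le> q" "p' \<le> q'"
  shows "question_mark (real (p + p') / real (q + q')) =
    (question_mark (real p / real q) + question_mark (real p' / real q')) / 2"
proof -
  have "int p' * int q - int p * int q' = 1" using arg_cong[OF assms(1), of int] by simp
  then have "farey_consecutive p q p' q'" using assms by (intro det_consecutive) auto
  then show ?thesis using is_question_mark_question_mark unfolding is_question_mark_def by blast
qed

lemma midpoint_diffs: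
  fixes a b c :: real
  assumes "c = (a + b) / 2"
  shows "b - c = (b - a) / 2" "c - a = (b - a) / 2"
  using assms by (simp_all add: field_simps)

text \<open>Every further mediant with the fixed endpoint P/Q is the midpoint of its parents under
  \<open>?\<close>, so the remaining \<open>?\<close>-distance to P/Q halves; the determinant 1
  persists along the chain.\<close>

lemma question_mark_left_chain:
  assumes "P * q = p * Q + 1" "1 \<le> q" "1 \<le> Q" "p \<le> q" "P \<le> Q"
  shows "question_mark (real P / real Q) - question_mark (real (p + k * P) / real (q + k * Q)) =
    (question_mark (real P / real Q) - question_mark (real p / real q)) / 2 ^ k"
proof (induction k)
  case (Suc k)
  have "question_mark (real ((p + k * P) + P) / real ((q + k * Q) + Q)) =
    (question_mark (real (p + k * P) / real (q + k * Q)) + question_mark (real P / real Q)) / 2"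
    using assms by (intro question_mark_mediant add_mono) (auto simp: algebra_simps)
  note mid = this
  have e: "(p + k * P) + P = p + Suc k * P" "(q + k * Q) + Q = q + Suc k * Q" by auto
  have "question_mark (real P / real Q) - question_mark (real (p + Suc k * P) / real (q + Suc k * Q)) =
    (question_mark (real P / real Q) - question_mark (real (p + k * P) / real (q + k * Q))) / 2"
    by (rule midpoint_diffs(1)[OF mid, unfolded e])
  also have "\<dots> = (question_mark (real P / real Q) - question_mark (real p / real q)) / 2 ^ Suc k"
    unfolding Suc.IH by simp
  finally show ?case .
qed simp

lemma question_mark_right_chain:
  assumes "p * Q = P * q + 1" "1 \<le> q" "1 \<le> Q" "p \<le> q" "P \<le> Q"
  shows "question_mark (real (p + k * P) / real (q + k * Q)) - question_mark (real P / real Q) =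
    (question_mark (real p / real q) - question_mark (real P / real Q)) / 2 ^ k"
proof (induction k)
  case (Suc k)
  have "question_mark (real (P + (p + k * P)) / real (Q + (q + k * Q))) =
    (question_mark (real P / real Q) + question_mark (real (p + k * P) / real (q + k * Q))) / 2"
    using assms by (intro question_mark_mediant add_mono) (auto simp: algebra_simps)
  note mid = this
  have e: "P + (p + k * P) = p + Suc k * P" "Q + (q + k * Q) = q + Suc k * Q" by auto
  have "question_mark (real (p + Suc k * P) / real (q + Suc k * Q)) - question_mark (real P / real Q) =
    (question_mark (real (p + k * P) / real (q + k * Q)) - question_mark (real P / real Q)) / 2"
    by (rule midpoint_diffs(2)[OF mid, unfolded e])
  also have "\<dots> = (question_mark (real p / real q) - question_mark (real P / real Q)) / 2 ^ Suc k"
    unfolding Suc.IH by simp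
  finally show ?case .
qed simp

text \<open>The sample points decrease to 0 only harmonically, the bounds on \<open>g\<close>
  geometrically. So the bound at the sample just above d can be compared with the sample just below
  d, using q + (k + 1) Q <= 2^k (q + Q).\<close>

lemma linear_bound_from_dyadic_samples:
  fixes g :: "real \<Rightarrow> real" and q Q E d :: real
  assumes pos: "0 < q" "0 < Q" "0 \<le> E" and g0: "g 0 \<le> 0"
    and mono: "\<And>u v. 0 \<le> u \<Longrightarrow> u \<le> v \<Longrightarrow> v \<le> 1 / (Q * q) \<Longrightarrow> g u \<le> g v"
    and samp: "\<And>k::nat. g (1 / (Q * (q + real k * Q))) \<le> E / 2 ^ k"
    and d: "0 \<le> d" "d \<le> 1 / (Q * q)"
  shows "g d \<le> E * Q * (q + Q) * d"
proof (cases "d = 0")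
  case False
  then have d0: "d > 0" using d by simp
  have ex: "\<exists>k::nat. 1 / (Q * (q + real (Suc k) * Q)) < d"
  proof -
    obtain k :: nat where k: "1 / (d * Q * Q) < real k" using reals_Archimedean2 by blast
    then have "1 < real k * (d * Q * Q)" using d0 pos by (simp add: divide_less_eq)
    also have "\<dots> \<le> d * (Q * (q + real (Suc k) * Q))" using d0 pos by (simp add: algebra_simps)
    finally have "1 / (Q * (q + real (Suc k) * Q)) < d"
      using pos by (simp add: divide_less_eq pos_add_strict)
    then show ?thesis by blast
  qed
  \<comment> \<open>Minimality of k places d between the samples of index k + 1 and k; for k = 0 the
    upper one is the end of the admissible range.\<close>
  define k where "k = (LEAST k::nat. 1 / (Q * (q + real (Suc k) * Q)) < d)"
  have k: "1 / (Q * (q + real (Suc k) * Q)) < d" unfolding k_def by (rule LeastI_ex[OF ex])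
  have kd: "d \<le> 1 / (Q * (q + real k * Q))"
  proof (cases k)
    case 0
    then show ?thesis using d by simp
  next
    case (Suc j)
    then have "\<not> 1 / (Q * (q + real (Suc j) * Q)) < d" unfolding k_def by (intro not_less_Least) simp
    then show ?thesis using Suc by simp
  qed
  have "1 / (Q * (q + real k * Q)) \<le> 1 / (Q * q)"
    using pos by (intro divide_left_mono mult_pos_pos add_pos_nonneg mult_left_mono) auto
  then have "g d \<le> E / 2 ^ k" using mono[OF d(1) kd] samp[of k] by linarith
  also have "\<dots> \<le> E * (Q * (q + Q) * d)"
  proof -
    have "1 < d * (Q * (q + real (Suc k) * Q))"
      using k pos by (simp add: divide_less_eq pos_add_strict)
    also have "\<dots> \<le> d * (Q * ((real k + 1) * (q + Q)))"
      using pos d0 by (intro mult_left_mono) (auto simp: algebra_simps)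
    also have "\<dots> \<le> d * (Q * (2 ^ k * (q + Q)))"
    proof -
      have "Suc k \<le> 2 ^ k" by (induction k) auto
      then have "real (Suc k) \<le> real (2 ^ k)" by (rule of_nat_mono)
      then show ?thesis using pos d0 by (intro mult_left_mono mult_right_mono) auto
    qed
    finally have "1 / 2 ^ k \<le> Q * (q + Q) * d" by (simp add: divide_le_eq algebra_simps)
    then show ?thesis using mult_left_mono[OF _ pos(3)] by fastforce
  qed
  finally show ?thesis by (simp add: mult.assoc)
qed (use g0 in simp)

lemma frac_diff_eq:
  fixes p q p' q' :: nat
  assumes "p' * q = p * q' + 1" "1 \<le> q" "1 \<le> q'"
  shows "real p' / real q' - real p / real q = 1 / (real q * real q')"
proof -
  have "real (p' * q) = real (p * q' + 1)" by (simp only: assms(1))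
  then show ?thesis using assms(2,3) by (simp add: field_simps)
qed

text \<open>Both neighbours of the mediant are approached along the chains of Farey fractions adjacent
  to it, on which \<open>?\<close> is explicit.\<close>

lemma question_mark_slope_across_mediant:
  assumes det: "p' * q = p * q' + 1" "1 \<le> q" "1 \<le> q'" "p \<le> q" "p' \<le> q'"
    and E: "question_mark (real p' / real q') - question_mark (real p / real q) = E"
    and u: "real p / real q \<le> u" "u \<le> real (p + p') / real (q + q')"
    and v: "real (p + p') / real (q + q') \<le> v" "v \<le> real p' / real q'"
  shows "question_mark v - question_mark u \<le> E * (real (q + q'))\<^sup>2 * (v - u)"
proof -
  define P Q where "P = p + p'" and "Q = q + q'"
  define m where "m = real P / real Q"
  have um: "real p / real q \<le> u" "u \<le> m" and vm: "m \<le> v" "v \<le> real p' / real q'"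
    using u v by (auto simp: m_def P_def Q_def)
  have dl: "P * q = p * Q + 1" and dr: "p' * Q = P * q' + 1" and PQ: "P \<le> Q" "1 \<le> Q"
    using det by (auto simp: P_def Q_def algebra_simps)
  have fm: "question_mark m = (question_mark (real p / real q) + question_mark (real p' / real q')) / 2"
    unfolding m_def P_def Q_def by (rule question_mark_mediant[OF det])
  have b: "0 \<le> real p / real q" "real p' / real q' \<le> 1" using det by auto
  have E0: "E \<ge> 0" using question_mark_mono[of "real p / real q" "real p' / real q'"] um vm b E by linarith
  have left: "question_mark m - question_mark u \<le> (E / 2) * real Q * (real q + real Q) * (m - u)"
  proof -
    have len: "m - real p / real q = 1 / (real Q * real q)"
      using frac_diff_eq[OF dl det(2) PQ(2)] by (simp add: m_def mult.commute)
    let ?g = "\<lambda>d. question_mark m - question_mark (m - d)"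
    have "?g (m - u) \<le> (E / 2) * real Q * (real q + real Q) * (m - u)"
    proof (rule linear_bound_from_dyadic_samples)
      fix s t :: real assume "0 \<le> s" "s \<le> t" "t \<le> 1 / (real Q * real q)"
      moreover from this have "0 \<le> m - t" using len b(1) by linarith
      ultimately show "?g s \<le> ?g t" using b um vm question_mark_mono[of "m - t" "m - s"] by linarith
    next
      fix k :: nat
      have "m - real (p + k * P) / real (q + k * Q) = 1 / (real (q + k * Q) * real Q)"
        unfolding m_def using det PQ dl by (intro frac_diff_eq) (auto simp: algebra_simps)
      then have "m - 1 / (real Q * (real q + real k * real Q)) = real (p + k * P) / real (q + k * Q)"
        by (simp add: algebra_simps)
      then show "?g (1 / (real Q * (real q + real k * real Q))) \<le> E / 2 / 2 ^ k"
        using question_mark_left_chain[OF dl det(2) PQ(2) det(4) PQ(1), of k]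
        unfolding m_def[symmetric] midpoint_diffs(2)[OF fm] E by simp
    qed (use det PQ E0 um len in auto)
    then show ?thesis by simp
  qed
  have right: "question_mark v - question_mark m \<le> (E / 2) * real Q * (real q' + real Q) * (v - m)"
  proof -
    have len: "real p' / real q' - m = 1 / (real Q * real q')"
      using frac_diff_eq[OF dr PQ(2) det(3)] by (simp add: m_def mult.commute)
    let ?g = "\<lambda>d. question_mark (m + d) - question_mark m"
    have "?g (v - m) \<le> (E / 2) * real Q * (real q' + real Q) * (v - m)"
    proof (rule linear_bound_from_dyadic_samples)
      fix s t :: real assume "0 \<le> s" "s \<le> t" "t \<le> 1 / (real Q * real q')"
      moreover from this have "m + t \<le> 1" "0 \<le> m" using len b um by linarith+
      ultimately show "?g s \<le> ?g t" using question_mark_mono[of "m + s" "m + t"] by linarith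
    next
      fix k :: nat
      have "real (p' + k * P) / real (q' + k * Q) - m = 1 / (real Q * real (q' + k * Q))"
        unfolding m_def using det PQ dr by (intro frac_diff_eq) (auto simp: algebra_simps)
      then have "m + 1 / (real Q * (real q' + real k * real Q)) = real (p' + k * P) / real (q' + k * Q)"
        by (simp add: algebra_simps)
      then show "?g (1 / (real Q * (real q' + real k * real Q))) \<le> E / 2 / 2 ^ k"
        using question_mark_right_chain[OF dr det(3) PQ(2) det(5) PQ(1), of k]
        unfolding m_def[symmetric] midpoint_diffs(1)[OF fm] E by simp
    qed (use det PQ E0 vm len in auto)
    then show ?thesis by simp
  qed
  \<comment> \<open>As q and q' are at most Q, both one-sided slopes are at most E Q^2, and the two
    increments add up.\<close>
  have "(E / 2) * real Q * (real q + real Q) * (m - u) \<le> (E / 2) * real Q * (2 * real Q) * (m - u)"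
    using E0 um by (intro mult_right_mono mult_left_mono) (auto simp: Q_def)
  moreover have "(E / 2) * real Q * (real q' + real Q) * (v - m) \<le> (E / 2) * real Q * (2 * real Q) * (v - m)"
    using E0 vm by (intro mult_right_mono mult_left_mono) (auto simp: Q_def)
  ultimately have "question_mark v - question_mark u \<le>
      (E / 2) * real Q * (2 * real Q) * (m - u) + (E / 2) * real Q * (2 * real Q) * (v - m)"
    using left right by linarith
  also have "\<dots> = E * (real Q)\<^sup>2 * (v - u)" by (simp add: algebra_simps power2_eq_square)
  finally show ?thesis by (simp add: Q_def)
qed

section \<open>Stern-Brocot intervals around a fixed irrational\<close>

locale irrational_unit =
  fixes x :: real
  assumes x01: "x \<in> {0<..<1}" and irr: "x \<notin> \<rat>"
begin

lemma linear_form_nonzero: "0 < q \<Longrightarrow> real q * x \<noteq> real p"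
proof
  assume "0 < q" "real q * x = real p"
  then have "x = real p / real q" by (simp add: field_simps)
  then show False using irr by simp
qed

text \<open>The position of x is stated without division so that it also covers the right endpoint
  1/0 at depth 0.\<close>

lemma sb_inv:
  assumes "sb x n = ((p, q), (p', q'))"
  shows "p' * q = p * q' + 1 \<and> real p < real q * x \<and> real q' * x < real p' \<and> 1 \<le> q"
  using assms
proof (induction n arbitrary: p q p' q')
  case 0
  then show ?case using x01 by auto
next
  case (Suc n)
  obtain a b a' b' where ab: "sb x n = ((a, b), (a', b'))" by (metis surj_pair)
  note IH = Suc.IH[OF ab]
  have "real (b + b') * x \<noteq> real (a + a')" using IH by (intro linear_form_nonzero) auto
  then show ?case using Suc.prems IH ab
    by (auto split: if_splits simp: algebra_simps not_less)
qed

text \<open>After the first step both endpoints are fractions in [0,1], so the mediant rule applies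
  and halves the \<open>?\<close>-length each time. The linear growth of q + q' is crude, but it
  makes the intervals shrink to x.\<close>

lemma sb_inv_Suc:
  assumes "sb x (Suc n) = ((p, q), (p', q'))"
  shows "1 \<le> q' \<and> p \<le> q \<and> p' \<le> q' \<and> n + 2 \<le> q + q' \<and>
    question_mark (real p' / real q') - question_mark (real p / real q) = 1 / 2 ^ n"
  using assms
proof (induction n arbitrary: p q p' q')
  case 0
  then show ?case using x01 by auto
next
  case (Suc n)
  obtain a b a' b' where ab: "sb x (Suc n) = ((a, b), (a', b'))" by (metis surj_pair)
  note IH = Suc.IH[OF ab]
  have i: "a' * b = a * b' + 1" "1 \<le> b" using sb_inv[OF ab] by auto
  have "question_mark (real (a + a') / real (b + b')) =
    (question_mark (real a / real b) + question_mark (real a' / real b')) / 2"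
    using IH i by (intro question_mark_mediant) auto
  from midpoint_diffs[OF this] have
    "question_mark (real (a + a') / real (b + b')) - question_mark (real a / real b) = 1 / 2 ^ Suc n"
    "question_mark (real a' / real b') - question_mark (real (a + a') / real (b + b')) = 1 / 2 ^ Suc n"
    using IH by simp_all
  then show ?case using Suc.prems IH i unfolding sb.simps(2)[of x "Suc n"] ab
    by (auto split: if_splits)
qed

lemma sb_mem:
  assumes "sb x (Suc n) = ((p, q), (p', q'))"
  shows "real p / real q < x" "x < real p' / real q'"
    "real p' / real q' - real p / real q = 1 / (real q * real q')"
    "0 \<le> real p / real q" "real p' / real q' \<le> 1"
  using sb_inv[OF assms] sb_inv_Suc[OF assms] frac_diff_eq[of p' q p q']
  by (auto simp: field_simps)

text \<open>The intervals have length at most 1/(n + 1), so x + \<delta> with \<delta> nonzero lies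
  in only finitely many of them; in the deepest one the mediant separates it from x. For small
  \<delta> the point lies in \<open>I n0\<close>, which forces this depth to be at least
  \<open>n0\<close>.\<close>

lemma eventually_separated:
  "eventually (\<lambda>\<delta>. \<exists>n p q p' q'. n0 \<le> n \<and> sb x (Suc n) = ((p, q), (p', q')) \<and>
     real p / real q \<le> x + \<delta> \<and> x + \<delta> \<le> real p' / real q' \<and>
     (x < real (p + p') / real (q + q') \<and> real (p + p') / real (q + q') \<le> x + \<delta> \<or>
      x + \<delta> \<le> real (p + p') / real (q + q') \<and> real (p + p') / real (q + q') < x)) (at 0)"
proof -
  define I where "I = (\<lambda>n. case sb x (Suc n) of ((p, q), (p', q')) \<Rightarrow> {real p / real q .. real p' / real q'})"
  obtain p q p' q' where s: "sb x (Suc n0) = ((p, q), (p', q'))" by (metis surj_pair)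
  define e where "e = min (x - real p / real q) (real p' / real q' - x)"
  have e: "e > 0" using sb_mem[OF s] by (simp add: e_def)
  have ev: "eventually (\<lambda>\<delta>::real. \<delta> \<noteq> 0 \<and> \<bar>\<delta>\<bar> < e) (at 0)"
    using e by (auto simp: eventually_at dist_real_def intro!: exI[of _ e])
  show ?thesis
  proof (rule eventually_mono[OF ev], goal_cases)
    case (1 \<delta>)
    have in0: "x + \<delta> \<in> I n0" using 1 s unfolding I_def e_def by (auto simp del: sb.simps)
    have bound: "n < nat \<lceil>1 / \<bar>\<delta>\<bar>\<rceil>" if h: "x + \<delta> \<in> I n" for n
    proof -
      obtain a b a' b' where ab: "sb x (Suc n) = ((a, b), (a', b'))" by (metis surj_pair)
      have "\<bar>\<delta>\<bar> \<le> real a' / real b' - real a / real b"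
        using h sb_mem[OF ab] unfolding I_def ab by (auto simp del: sb.simps)
      also have "\<dots> = 1 / (real b * real b')" using sb_mem[OF ab] by simp
      also have "\<dots> \<le> 1 / real (n + 1)"
      proof -
        have g: "1 \<le> b" "1 \<le> b'" "n + 2 \<le> b + b'" using sb_inv[OF ab] sb_inv_Suc[OF ab] by auto
        obtain c c' where c: "b = Suc c" "b' = Suc c'" using g by (metis Suc_le_D One_nat_def)
        \<comment> \<open>This is (b - 1) (b' - 1) >= 0 combined with n + 2 <= b + b'.\<close>
        have "n + 1 \<le> b * b'" using g unfolding c by simp
        then have "real (n + 1) \<le> real (b * b')" by (rule of_nat_mono)
        then show ?thesis by (intro divide_left_mono) (use g in auto)
      qed
      finally have "real (n + 1) \<le> 1 / \<bar>\<delta>\<bar>" using 1 by (simp add: field_simps)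
      then have "real (n + 1) \<le> real_of_int \<lceil>1 / \<bar>\<delta>\<bar>\<rceil>" by linarith
      then show ?thesis by linarith
    qed
    define n where "n = Max {n. x + \<delta> \<in> I n}"
    have fin: "finite {n. x + \<delta> \<in> I n}"
      by (rule finite_subset[of _ "{..< nat \<lceil>1 / \<bar>\<delta>\<bar>\<rceil>}"]) (use bound in auto)
    have nI: "x + \<delta> \<in> I n" using Max_in[OF fin] in0 unfolding n_def by auto
    have n0: "n0 \<le> n" using Max_ge[OF fin] in0 unfolding n_def by auto
    have nS: "x + \<delta> \<notin> I (Suc n)"
    proof
      assume "x + \<delta> \<in> I (Suc n)"
      then have "Suc n \<le> n" using Max_ge[OF fin] unfolding n_def by auto
      then show False by simp
    qed
    obtain a b a' b' where ab: "sb x (Suc n) = ((a, b), (a', b'))" by (metis surj_pair)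
    have b: "1 \<le> b" using sb_inv[OF ab] by simp
    have ne: "real (b + b') * x \<noteq> real (a + a')" using b by (intro linear_form_nonzero) auto
    have lt: "real (b + b') * x < real (a + a') \<longleftrightarrow> x < real (a + a') / real (b + b')"
      using b by (simp add: field_simps)
    have gt: "real (b + b') * x > real (a + a') \<longleftrightarrow> x > real (a + a') / real (b + b')"
      using b by (simp add: field_simps)
    have "x + \<delta> \<in> {real a / real b .. real a' / real b'}" using nI unfolding I_def ab by simp
    moreover have "x < real (a + a') / real (b + b') \<and> real (a + a') / real (b + b') \<le> x + \<delta> \<or>
      x + \<delta> \<le> real (a + a') / real (b + b') \<and> real (a + a') / real (b + b') < x"
    proof (cases "real (b + b') * x < real (a + a')")
      case True
      have "sb x (Suc (Suc n)) = ((a, b), (a + a', b + b'))"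
        unfolding sb.simps(2)[of x "Suc n"] ab using True by simp
      then have "\<not> x + \<delta> \<le> real (a + a') / real (b + b')"
        using nS nI unfolding I_def ab by (auto simp del: sb.simps)
      then show ?thesis using True lt by linarith
    next
      case False
      have "sb x (Suc (Suc n)) = ((a + a', b + b'), (a', b'))"
        unfolding sb.simps(2)[of x "Suc n"] ab using False by simp
      then have "\<not> real (a + a') / real (b + b') \<le> x + \<delta>"
        using nS nI unfolding I_def ab by (auto simp del: sb.simps)
      then show ?thesis using False ne gt by linarith
    qed
    ultimately show ?case using ab n0 by simp blast
  qed
qed

text \<open>At the step where the mediant ceases to be an endpoint, the half interval next to it is
  discarded. That half separates it from x, and its \<open>?\<close>-length is smallest, namely
  2^-(n + k + 1), if this happens at the last step.\<close>

lemma mediant_gap: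
  assumes "sb x (Suc n) = ((p, q), (p', q'))" "sb x (Suc n + Suc k) = ((a, b), (a', b'))"
    and "(a, b) \<noteq> (p + p', q + q')" "(a', b') \<noteq> (p + p', q + q')"
  shows "1 / 2 ^ (n + k + 1) \<le> \<bar>question_mark (real (p + p') / real (q + q')) - question_mark x\<bar>"
  using assms(2-)
proof (induction k arbitrary: a b a' b')
  \<comment> \<open>One level further down the mediant is always an endpoint, so the hypotheses are
    contradictory.\<close>
  case 0
  then show ?case using assms(1) by (auto split: if_splits simp del: sb.simps simp: sb.simps(2)[of x "Suc n"])
next
  case (Suc k)
  obtain c d c' d' where cd: "sb x (Suc n + Suc k) = ((c, d), (c', d'))" by (metis surj_pair)
  then have cd': "sb x (Suc (n + k + 1)) = ((c, d), (c', d'))" by simp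
  have st: "sb x (Suc (Suc (n + k + 1))) = ((a, b), (a', b'))" using Suc.prems by simp
  have i: "c' * d = c * d' + 1" "1 \<le> d" "1 \<le> d'" "c \<le> d" "c' \<le> d'"
    "question_mark (real c' / real d') - question_mark (real c / real d) = 1 / 2 ^ (n + k + 1)"
    using sb_inv[OF cd'] sb_inv_Suc[OF cd'] by auto
  from midpoint_diffs[OF question_mark_mediant[OF i(1-5)]]
  have half: "question_mark (real (c + c') / real (d + d')) - question_mark (real c / real d) = 1 / 2 ^ (n + Suc k + 1)"
    "question_mark (real c' / real d') - question_mark (real (c + c') / real (d + d')) = 1 / 2 ^ (n + Suc k + 1)"
    unfolding i(6) by simp_all
  show ?case
  proof (cases "(c, d) \<noteq> (p + p', q + q') \<and> (c', d') \<noteq> (p + p', q + q')")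
    case True
    have "1 / 2 ^ (n + Suc k + 1) \<le> (1 / 2 ^ (n + k + 1) :: real)" by (simp add: field_simps)
    also have "\<dots> \<le> \<bar>question_mark (real (p + p') / real (q + q')) - question_mark x\<bar>"
      using Suc.IH[OF cd] True by blast
    finally show ?thesis .
  next
    case False
    have step: "((a, b), (a', b')) = (if real (d + d') * x < real (c + c') then ((c, d), (c + c', d + d'))
        else ((c + c', d + d'), (c', d')))"
      using st unfolding sb.simps(2)[of x "Suc (n + k + 1)"] cd' by simp
    have ab: "real a / real b < x" "x < real a' / real b'" "0 \<le> real a / real b" "real a' / real b' \<le> 1"
      using sb_mem[OF st] by auto
    show ?thesis
    proof (cases "real (d + d') * x < real (c + c')")
      case True
      then have e: "a' = c + c'" "b' = d + d'" "c' = p + p'" "d' = q + q'"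
        using step False Suc.prems by auto
      have "question_mark x \<le> question_mark (real a' / real b')"
        using ab x01 by (intro question_mark_mono) auto
      then show ?thesis using half(2) unfolding e(1,2) unfolding e(3,4) by linarith
    next
      case F: False
      then have e: "a = c + c'" "b = d + d'" "c = p + p'" "d = q + q'"
        using step False Suc.prems by auto
      have "question_mark (real a / real b) \<le> question_mark x"
        using ab x01 by (intro question_mark_mono) auto
      then show ?thesis using half(1) unfolding e(1,2) unfolding e(3,4) by linarith
    qed
  qed
qed

lemma separated_slope_upper:
  assumes s: "sb x (Suc n) = ((p, q), (p', q'))"
    and mem: "real p / real q \<le> x + \<delta>" "x + \<delta> \<le> real p' / real q'"
    and sep: "x < real (p + p') / real (q + q') \<and> real (p + p') / real (q + q') \<le> x + \<delta> \<or>
      x + \<delta> \<le> real (p + p') / real (q + q') \<and> real (p + p') / real (q + q') < x"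
  shows "\<bar>(question_mark (x + \<delta>) - question_mark x) / \<delta>\<bar> \<le> (real (q + q'))\<^sup>2 / 2 ^ n"
proof -
  have i: "p' * q = p * q' + 1" "1 \<le> q" "1 \<le> q'" "p \<le> q" "p' \<le> q'"
    "question_mark (real p' / real q') - question_mark (real p / real q) = 1 / 2 ^ n"
    using sb_inv[OF s] sb_inv_Suc[OF s] by auto
  note m = sb_mem[OF s]
  have nz: "\<delta> \<noteq> 0" using sep by auto
  have "\<bar>question_mark (x + \<delta>) - question_mark x\<bar> \<le> 1 / 2 ^ n * (real (q + q'))\<^sup>2 * \<bar>\<delta>\<bar>"
    using sep
  proof
    assume h: "x < real (p + p') / real (q + q') \<and> real (p + p') / real (q + q') \<le> x + \<delta>"
    have "question_mark (x + \<delta>) - question_mark x \<le> 1 / 2 ^ n * (real (q + q'))\<^sup>2 * (x + \<delta> - x)"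
      using h m mem by (intro question_mark_slope_across_mediant[OF i]) auto
    moreover have "question_mark x \<le> question_mark (x + \<delta>)" "\<delta> > 0"
      using h m mem x01 by (auto intro!: question_mark_mono)
    ultimately show ?thesis by simp
  next
    assume h: "x + \<delta> \<le> real (p + p') / real (q + q') \<and> real (p + p') / real (q + q') < x"
    have "question_mark x - question_mark (x + \<delta>) \<le> 1 / 2 ^ n * (real (q + q'))\<^sup>2 * (x - (x + \<delta>))"
      using h m mem by (intro question_mark_slope_across_mediant[OF i]) auto
    moreover have "0 \<le> x + \<delta>" using m(4) mem(1) by linarith
    then have "question_mark (x + \<delta>) \<le> question_mark x" "\<delta> < 0"
      using h x01 by (auto intro!: question_mark_mono)
    ultimately show ?thesis by simp
  qed
  then show ?thesis using nz by (simp add: divide_le_eq)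
qed

text \<open>The increment of \<open>?\<close> is at least the one between x and the mediant, bounded
  by \<open>mediant_gap\<close>, while |\<delta>| is at most the interval length 1/(q q'). Comparing
  denominators suffices to see that the mediant is no longer an endpoint.\<close>

lemma separated_slope_lower:
  assumes s: "sb x (Suc n) = ((p, q), (p', q'))" and s': "sb x (Suc n + Suc k) = ((a, b), (a', b'))"
    and new: "b \<noteq> q + q'" "b' \<noteq> q + q'"
    and mem: "real p / real q \<le> x + \<delta>" "x + \<delta> \<le> real p' / real q'"
    and sep: "x < real (p + p') / real (q + q') \<and> real (p + p') / real (q + q') \<le> x + \<delta> \<or>
      x + \<delta> \<le> real (p + p') / real (q + q') \<and> real (p + p') / real (q + q') < x"
  shows "real (q * q') / 2 ^ (n + k + 1) \<le> (question_mark (x + \<delta>) - question_mark x) / \<delta>"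
proof -
  note m = sb_mem[OF s]
  have q: "1 \<le> q" "1 \<le> q'" using sb_inv[OF s] sb_inv_Suc[OF s] by auto
  define M where "M = real (p + p') / real (q + q')"
  have gap: "1 / 2 ^ (n + k + 1) \<le> \<bar>question_mark M - question_mark x\<bar>"
    unfolding M_def using mediant_gap[OF s s'] new by auto
  have len: "\<bar>\<delta>\<bar> \<le> 1 / (real q * real q')" using m mem by linarith
  have fin: "real (q * q') / 2 ^ (n + k + 1) \<le> D / \<bar>\<delta>\<bar>" if D: "1 / 2 ^ (n + k + 1) \<le> D" and "\<delta> \<noteq> 0" for D
  proof -
    have "real (q * q') * \<bar>\<delta>\<bar> \<le> 1" using len q by (simp add: field_simps)
    then have "real (q * q') * \<bar>\<delta>\<bar> * (1 / 2 ^ (n + k + 1)) \<le> 1 * (1 / 2 ^ (n + k + 1))"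
      by (intro mult_right_mono) auto
    then show ?thesis using D that(2) by (simp add: field_simps)
  qed
  show ?thesis
    using sep
  proof
    assume h: "x < real (p + p') / real (q + q') \<and> real (p + p') / real (q + q') \<le> x + \<delta>"
    then have d: "\<delta> > 0" by linarith
    have "question_mark x \<le> question_mark M" "question_mark M \<le> question_mark (x + \<delta>)"
      using h m mem x01 unfolding M_def by (auto intro!: question_mark_mono)
    then have "1 / 2 ^ (n + k + 1) \<le> question_mark (x + \<delta>) - question_mark x" using gap by linarith
    from fin[OF this] show ?thesis using d by simp
  next
    assume h: "x + \<delta> \<le> real (p + p') / real (q + q') \<and> real (p + p') / real (q + q') < x"
    then have d: "\<delta> < 0" by linarith
    have "0 \<le> x + \<delta>" using m(4) mem(1) by linarith
    then have "question_mark (x + \<delta>) \<le> question_mark M" "question_mark M \<le> question_mark x"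
      using h x01 unfolding M_def by (auto intro!: question_mark_mono)
    then have "1 / 2 ^ (n + k + 1) \<le> question_mark x - question_mark (x + \<delta>)" using gap by linarith
    from fin[OF this] show ?thesis using d by (simp add: minus_divide_left[symmetric] field_simps)
  qed
qed

end

section \<open>Convergents along the path\<close>

text \<open>Index shift: \<open>cf_den a (t + 1)\<close> is the denominator \<open>q\<^sub>t\<close> of the \<open>t\<close>-th convergent
  of \<open>[0; a 1, a 2, \<dots>]\<close>; the value \<open>a 0\<close> is irrelevant.\<close>

fun cf_den :: "(nat \<Rightarrow> nat) \<Rightarrow> nat \<Rightarrow> nat" where
  "cf_den a 0 = 0"
| "cf_den a (Suc 0) = 1"
| "cf_den a (Suc (Suc t)) = a (Suc t) * cf_den a (Suc t) + cf_den a t"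

text \<open>The last hypothesis says that x lies left of (p' + k p)/(q' + k q). These mediants
  decrease in k, so all earlier steps go left as well.\<close>

lemma sb_left_run:
  assumes "sb x n = ((p, q), (p', q'))" "real p < real q * x"
    and "real k * (real q * x - real p) < real p' - real q' * x"
  shows "sb x (n + k) = ((p, q), (p' + k * p, q' + k * q))"
  using assms(3)
proof (induction k)
  case (Suc k)
  have "real k * (real q * x - real p) \<le> real (Suc k) * (real q * x - real p)"
    using assms(2) by (intro mult_right_mono) auto
  then have "sb x (n + k) = ((p, q), (p' + k * p, q' + k * q))" using Suc by auto
  then show ?case using Suc.prems by (simp add: algebra_simps)
qed (use assms in simp)

lemma sb_right_run:
  assumes "sb x n = ((p, q), (p', q'))" "real q' * x < real p'"
    and "real k * (real p' - real q' * x) < real q * x - real p"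
  shows "sb x (n + k) = ((p + k * p', q + k * q'), (p', q'))"
  using assms(3)
proof (induction k)
  case (Suc k)
  have "real k * (real p' - real q' * x) \<le> real (Suc k) * (real p' - real q' * x)"
    using assms(2) by (intro mult_right_mono) auto
  then have "sb x (n + k) = ((p + k * p', q + k * q'), (p', q'))" using Suc by auto
  then show ?case using Suc.prems by (simp add: algebra_simps)
qed (use assms in simp)

lemma pq_sum_Suc: "pq_sum x (Suc t) = pq_sum x t + partial_quotient x (Suc t)"
  by (simp add: pq_sum_def)

lemma pq_sum_0 [simp]: "pq_sum x 0 = 0"
  by (simp add: pq_sum_def)

context irrational_unit
begin

lemma gauss_iterate: "(gauss_map ^^ t) x \<in> {0<..<1} \<and> (gauss_map ^^ t) x \<notin> \<rat>"
proof (induction t)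
  case 0
  then show ?case using x01 irr by simp
next
  case (Suc t)
  define y where "y = (gauss_map ^^ t) x"
  have "1 / y \<notin> \<rat>" using Suc Rats_divide[of 1 "1 / y"] by (auto simp: y_def)
  moreover have "frac (1 / y) = 1 / y - of_int \<lfloor>1 / y\<rfloor>" by (simp add: frac_def)
  ultimately have nr: "frac (1 / y) \<notin> \<rat>"
    by (metis Rats_add Rats_of_int diff_add_cancel)
  then have "frac (1 / y) \<noteq> 0" by (metis Rats_0)
  moreover have "(gauss_map ^^ Suc t) x = frac (1 / y)" by (simp add: gauss_map_def y_def)
  ultimately show ?case using nr frac_ge_0[of "1 / y"] frac_lt_1[of "1 / y"] by (auto simp del: funpow.simps)
qed

lemma gauss_iterate_Suc:
  "(gauss_map ^^ Suc t) x = 1 / (gauss_map ^^ t) x - real (partial_quotient x (Suc t))"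
proof -
  define y where "y = (gauss_map ^^ t) x"
  have "y > 0" using gauss_iterate[of t] by (simp add: y_def)
  then have "0 \<le> \<lfloor>1 / y\<rfloor>" by simp
  then have "real (nat \<lfloor>1 / y\<rfloor>) = of_int \<lfloor>1 / y\<rfloor>" by simp
  then show ?thesis by (simp add: gauss_map_def partial_quotient_def frac_def y_def)
qed

lemma partial_quotient_pos: "1 \<le> partial_quotient x (Suc t)"
proof -
  define y where "y = (gauss_map ^^ t) x"
  have "0 < y" "y < 1" using gauss_iterate[of t] by (auto simp: y_def)
  then have "1 \<le> \<lfloor>1 / y\<rfloor>" by (simp add: le_floor_iff)
  then have "1 \<le> nat \<lfloor>1 / y\<rfloor>" by linarith
  then show ?thesis by (simp add: partial_quotient_def y_def)
qed

text \<open>The product is 1 minus the product of two consecutive Gauss iterates. This is what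
  allows a run of a_(t+1) equal steps.\<close>

lemma partial_quotient_times_less: "real (partial_quotient x (Suc t)) * (gauss_map ^^ t) x < 1"
proof -
  define y z where "y = (gauss_map ^^ t) x" and "z = (gauss_map ^^ Suc t) x"
  have "0 < y" "0 < z" using gauss_iterate[of t] gauss_iterate[of "Suc t"] unfolding y_def z_def by auto
  moreover from this have "real (partial_quotient x (Suc t)) * y = 1 - y * z"
    using gauss_iterate_Suc[of t] unfolding y_def[symmetric] z_def[symmetric] by (simp add: field_simps)
  ultimately show ?thesis by (simp add: y_def)
qed

text \<open>At depth S_x(t) the endpoints are two consecutive convergents; the next a_(t+1) steps
  keep the newer one and move the other. Only denominators enter the estimates, so the numerators
  and the side are left open.\<close>

lemma sb_within_run:
  assumes b: "b \<le> partial_quotient x (Suc t)"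
  shows "\<exists>p p'.
     sb x (pq_sum x t + b) = ((p, cf_den (partial_quotient x) (Suc t)),
       (p', cf_den (partial_quotient x) t + b * cf_den (partial_quotient x) (Suc t))) \<or>
     sb x (pq_sum x t + b) = ((p, cf_den (partial_quotient x) t + b * cf_den (partial_quotient x) (Suc t)),
       (p', cf_den (partial_quotient x) (Suc t)))"
proof -
  let ?a = "partial_quotient x" and ?g = "\<lambda>t. (gauss_map ^^ t) x"
  let ?D = "cf_den ?a"
  \<comment> \<open>Besides the denominators, the invariant records that |q_t x - p_t| divided by
    |q_(t-1) x - p_(t-1)| is the t-th Gauss iterate; the parity of t decides which convergent is on
    the left.\<close>
  let ?I = "\<lambda>t p p'. if even t
     then sb x (pq_sum x t) = ((p, ?D (Suc t)), (p', ?D t)) \<and>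
       real (?D (Suc t)) * x - real p = ?g t * (real p' - real (?D t) * x)
     else sb x (pq_sum x t) = ((p, ?D t), (p', ?D (Suc t))) \<and>
       real p' - real (?D (Suc t)) * x = ?g t * (real (?D t) * x - real p)"
  have le: "real b * ?g t < 1" if "b \<le> ?a (Suc t)" for b t
  proof -
    have "real b * ?g t \<le> real (?a (Suc t)) * ?g t"
      using gauss_iterate[of t] that by (intro mult_right_mono) auto
    then show ?thesis using partial_quotient_times_less[of t] by linarith
  qed
  have run_even: "sb x (pq_sum x t + b) = ((p, ?D (Suc t)), (p' + b * p, ?D t + b * ?D (Suc t)))"
    if I: "?I t p p'" and ev: "even t" and b: "b \<le> ?a (Suc t)" for t b p p'
  proof (rule sb_left_run)
    show s: "sb x (pq_sum x t) = ((p, ?D (Suc t)), (p', ?D t))" using I ev by simp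
    show "real p < real (?D (Suc t)) * x" using sb_inv[OF s] by simp
    have "0 < real p' - real (?D t) * x" using sb_inv[OF s] by simp
    then have "real b * ?g t * (real p' - real (?D t) * x) < 1 * (real p' - real (?D t) * x)"
      by (intro mult_strict_right_mono le b)
    then show "real b * (real (?D (Suc t)) * x - real p) < real p' - real (?D t) * x"
      using I ev by (simp add: mult.assoc)
  qed
  have run_odd: "sb x (pq_sum x t + b) = ((p + b * p', ?D t + b * ?D (Suc t)), (p', ?D (Suc t)))"
    if I: "?I t p p'" and od: "odd t" and b: "b \<le> ?a (Suc t)" for t b p p'
  proof (rule sb_right_run)
    show s: "sb x (pq_sum x t) = ((p, ?D t), (p', ?D (Suc t)))" using I od by simp
    show "real (?D (Suc t)) * x < real p'" using sb_inv[OF s] by simp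
    have "0 < real (?D t) * x - real p" using sb_inv[OF s] by simp
    then have "real b * ?g t * (real (?D t) * x - real p) < 1 * (real (?D t) * x - real p)"
      by (intro mult_strict_right_mono le b)
    then show "real b * (real p' - real (?D (Suc t)) * x) < real (?D t) * x - real p"
      using I od by (simp add: mult.assoc)
  qed
  \<comment> \<open>Here u and w are the newer and the older distance. After c steps the older one
    has become w - c u, and its ratio to u is the next Gauss iterate.\<close>
  have shift: "w - c * u = z' * u" if "u = z * w" "z \<noteq> 0" "z' = 1 / z - c" for u w z z' c :: real
    by (simp add: that(1,3) left_diff_distrib that(2))
  have I: "\<exists>p p'. ?I t p p'" for t
  proof (induction t)
    case 0
    then show ?case by simp
  next
    case (Suc t)
    then obtain p p' where I: "?I t p p'" by blast
    have g: "?g t \<noteq> 0" "?g (Suc t) = 1 / ?g t - real (?a (Suc t))"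
      using gauss_iterate[of t] gauss_iterate_Suc[of t] by auto
    show ?case
    proof (cases "even t")
      case True
      have "?I (Suc t) p (p' + ?a (Suc t) * p)"
        using run_even[OF I True order_refl] True shift[OF conjunct2[OF I[unfolded if_P[OF True]]] g]
        by (simp add: pq_sum_Suc algebra_simps del: funpow.simps sb.simps)
      then show ?thesis by blast
    next
      case False
      have "?I (Suc t) (p + ?a (Suc t) * p') p'"
        using run_odd[OF I False order_refl] False shift[OF conjunct2[OF I[unfolded if_not_P[OF False]]] g]
        by (simp add: pq_sum_Suc algebra_simps del: funpow.simps sb.simps)
      then show ?thesis by blast
    qed
  qed
  obtain p p' where I': "?I t p p'" using I by blast
  show "\<exists>p p'. sb x (pq_sum x t + b) = ((p, ?D (Suc t)), (p', ?D t + b * ?D (Suc t))) \<or>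
     sb x (pq_sum x t + b) = ((p, ?D t + b * ?D (Suc t)), (p', ?D (Suc t)))"
    using run_even[OF I' _ b] run_odd[OF I' _ b] by blast
qed

end

lemma cf_den_mono_Suc: "(\<And>t. 1 \<le> a (Suc t)) \<Longrightarrow> cf_den a t \<le> cf_den a (Suc t)"
  by (cases t) (auto simp: mult_eq_if dest: order_trans intro!: trans_le_add1)

lemma cf_den_pos: "(\<And>t. 1 \<le> a (Suc t)) \<Longrightarrow> 1 \<le> cf_den a (Suc t)"
proof (induction t)
  case (Suc t)
  then have "1 \<le> cf_den a (Suc t)" by blast
  also have "\<dots> \<le> cf_den a (Suc (Suc t))" by (intro cf_den_mono_Suc Suc.prems)
  finally show ?case .
qed simp

section \<open>Derivative criteria\<close>

context irrational_unit
begin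

lemma depth_decomposition: "\<exists>t b. n = pq_sum x t + b \<and> b < partial_quotient x (Suc t)"
proof (induction n)
  case 0
  show ?case using partial_quotient_pos[of 0] by (intro exI[of _ 0]) auto
next
  case (Suc n)
  then obtain t b where tb: "n = pq_sum x t + b" "b < partial_quotient x (Suc t)" by blast
  show ?case
  proof (cases "Suc b < partial_quotient x (Suc t)")
    case True
    then show ?thesis using tb by (intro exI[of _ t] exI[of _ "Suc b"]) simp
  next
    case False
    then show ?thesis using tb partial_quotient_pos[of "Suc t"]
      by (intro exI[of _ "Suc t"] exI[of _ 0]) (simp add: pq_sum_Suc)
  qed
qed

lemma pq_sum_mono: "s \<le> t \<Longrightarrow> pq_sum x s \<le> pq_sum x t"
  by (auto simp: pq_sum_def intro!: sum_mono2)

lemma large_depth_decomposition: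
  assumes "pq_sum x T \<le> n"
  obtains t b where "T \<le> t" "n = pq_sum x t + b" "b < partial_quotient x (Suc t)"
proof -
  obtain t b where tb: "n = pq_sum x t + b" "b < partial_quotient x (Suc t)"
    using depth_decomposition by blast
  have "T \<le> t"
  proof (rule ccontr)
    assume "\<not> T \<le> t"
    then have "pq_sum x (Suc t) \<le> pq_sum x T" by (intro pq_sum_mono) simp
    then show False using tb assms by (simp add: pq_sum_Suc)
  qed
  then show thesis using that tb by blast
qed

text \<open>Within a run denominators grow linearly but powers of two exponentially, so the start of
  the run decides. The maximum of (b + 2)^2 / 2^b is 9/2, at b = 1; the doubling (b + 3)^2 <= 2 (b +
  2)^2 fails only at b = 0.\<close>

lemma square_le_power2: "(b + 2)\<^sup>2 \<le> 5 * 2 ^ b" for b :: nat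
proof (induction b)
  case (Suc b)
  show ?case
  proof (cases "b = 0")
    case False
    then have "1 \<le> b * b" by simp
    then show ?thesis using Suc by (simp add: power2_eq_square algebra_simps)
  qed (use Suc in \<open>simp add: power2_eq_square\<close>)
qed (simp add: power2_eq_square)

theorem question_mark_derivative_zero:
  assumes lim: "(\<lambda>t. (real (cf_den (partial_quotient x) (Suc t)))\<^sup>2 / 2 ^ pq_sum x t) \<longlonglongrightarrow> 0"
  shows "has_extended_derivative question_mark 0 x"
proof -
  let ?a = "partial_quotient x"
  let ?D = "cf_den ?a"
  note pos = partial_quotient_pos
  have "((\<lambda>\<delta>. (question_mark (x + \<delta>) - question_mark x) / \<delta>) \<longlongrightarrow> 0) (at 0)"
  proof (rule tendstoI)
    fix e :: real assume e: "e > 0"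
    \<comment> \<open>The 10 is the 5 of \<open>square_le_power2\<close> times a 2 for depth
      \<open>Suc n\<close> against \<open>?\<close>-length 2^-n.\<close>
    have "eventually (\<lambda>t. (real (?D (Suc t)))\<^sup>2 / 2 ^ pq_sum x t < e / 10) sequentially"
      using order_tendstoD(2)[OF lim, of "e / 10"] e by simp
    then obtain T where T: "\<And>t. T \<le> t \<Longrightarrow> (real (?D (Suc t)))\<^sup>2 / 2 ^ pq_sum x t < e / 10"
      by (auto simp: eventually_sequentially)
    show "eventually (\<lambda>\<delta>. dist ((question_mark (x + \<delta>) - question_mark x) / \<delta>) 0 < e) (at 0)"
    proof (rule eventually_mono[OF eventually_separated[of "pq_sum x T"]])
      fix \<delta>
      assume "\<exists>n p q p' q'. pq_sum x T \<le> n \<and> sb x (Suc n) = ((p, q), (p', q')) \<and>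
         real p / real q \<le> x + \<delta> \<and> x + \<delta> \<le> real p' / real q' \<and>
         (x < real (p + p') / real (q + q') \<and> real (p + p') / real (q + q') \<le> x + \<delta> \<or>
          x + \<delta> \<le> real (p + p') / real (q + q') \<and> real (p + p') / real (q + q') < x)"
      then obtain n p q p' q' where n: "pq_sum x T \<le> n" "sb x (Suc n) = ((p, q), (p', q'))"
        and up: "\<bar>(question_mark (x + \<delta>) - question_mark x) / \<delta>\<bar> \<le> (real (q + q'))\<^sup>2 / 2 ^ n"
        using separated_slope_upper by blast
      have "pq_sum x T \<le> Suc n" using n by simp
      then obtain t b where t: "T \<le> t" "Suc n = pq_sum x t + b" "b < partial_quotient x (Suc t)"
        by (rule large_depth_decomposition)
      have "q + q' = ?D t + (b + 1) * ?D (Suc t)"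
        using sb_within_run[of b t] t n by (auto simp del: sb.simps)
      also have "\<dots> \<le> (b + 2) * ?D (Suc t)" using cf_den_mono_Suc[of ?a t, OF pos] by simp
      finally have "(q + q')\<^sup>2 \<le> ((b + 2) * ?D (Suc t))\<^sup>2" by (intro power_mono) auto
      also have "\<dots> \<le> 5 * 2 ^ b * (?D (Suc t))\<^sup>2"
        unfolding power_mult_distrib by (intro mult_right_mono square_le_power2) auto
      finally have "real ((q + q')\<^sup>2) \<le> real (5 * 2 ^ b * (?D (Suc t))\<^sup>2)" by (rule of_nat_mono)
      then have sq: "(real (q + q'))\<^sup>2 \<le> 5 * 2 ^ b * (real (?D (Suc t)))\<^sup>2" by simp
      have "(real (q + q'))\<^sup>2 / 2 ^ n = 2 * ((real (q + q'))\<^sup>2 / 2 ^ Suc n)" by simp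
      also have "\<dots> \<le> 2 * (5 * 2 ^ b * (real (?D (Suc t)))\<^sup>2 / 2 ^ Suc n)"
        using sq by (intro mult_left_mono divide_right_mono) auto
      also have "\<dots> = 10 * ((real (?D (Suc t)))\<^sup>2 / 2 ^ pq_sum x t)"
        unfolding t(2) power_add by simp
      also have "\<dots> < e" using T[OF t(1)] by linarith
      finally show "dist ((question_mark (x + \<delta>) - question_mark x) / \<delta>) 0 < e" using up by simp
    qed
  qed
  then show ?thesis unfolding has_extended_derivative_def zero_ereal_def by (intro tendsto_ereal)
qed

text \<open>A mediant formed in run t + 1 has denominator at most q_(t+1), and one step after run t
  + 2 both endpoints have denominator at least q_(t+2), which is larger. So the mediant has gone by
  then. During run t + 1 the product q q' is least at the start, where it is q_t q_(t-1).\<close>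

theorem question_mark_derivative_infinity:
  assumes lim: "filterlim (\<lambda>t. real (cf_den (partial_quotient x) (Suc t) * cf_den (partial_quotient x) t) /
      2 ^ pq_sum x (t + 2)) at_top sequentially"
  shows "has_extended_derivative question_mark \<infinity> x"
  unfolding has_extended_derivative_def tendsto_PInfty
proof
  let ?a = "partial_quotient x"
  let ?D = "cf_den ?a"
  note pos = partial_quotient_pos
  fix C :: real
  have "eventually (\<lambda>t. C < real (?D (Suc t) * ?D t) / 2 ^ pq_sum x (t + 2)) sequentially"
    using lim by (auto simp: filterlim_at_top_dense)
  then obtain T where T: "\<And>t. T \<le> t \<Longrightarrow> C < real (?D (Suc t) * ?D t) / 2 ^ pq_sum x (t + 2)"
    by (auto simp: eventually_sequentially)
  show "eventually (\<lambda>\<delta>. ereal C < ereal ((question_mark (x + \<delta>) - question_mark x) / \<delta>)) (at 0)"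
  proof (rule eventually_mono[OF eventually_separated[of "pq_sum x T"]])
    fix \<delta>
    assume "\<exists>n p q p' q'. pq_sum x T \<le> n \<and> sb x (Suc n) = ((p, q), (p', q')) \<and>
       real p / real q \<le> x + \<delta> \<and> x + \<delta> \<le> real p' / real q' \<and>
       (x < real (p + p') / real (q + q') \<and> real (p + p') / real (q + q') \<le> x + \<delta> \<or>
        x + \<delta> \<le> real (p + p') / real (q + q') \<and> real (p + p') / real (q + q') < x)"
    then obtain n p q p' q' where n: "pq_sum x T \<le> n" "sb x (Suc n) = ((p, q), (p', q'))"
      and mem: "real p / real q \<le> x + \<delta>" "x + \<delta> \<le> real p' / real q'"
      and sep: "x < real (p + p') / real (q + q') \<and> real (p + p') / real (q + q') \<le> x + \<delta> \<or>
        x + \<delta> \<le> real (p + p') / real (q + q') \<and> real (p + p') / real (q + q') < x"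
      by blast
    have "pq_sum x T \<le> Suc n" using n by simp
    then obtain t b where t: "T \<le> t" "Suc n = pq_sum x t + b" "b < ?a (Suc t)"
      by (rule large_depth_decomposition)
    have qq: "q + q' = ?D t + (b + 1) * ?D (Suc t)" "q * q' = ?D (Suc t) * (?D t + b * ?D (Suc t))"
      using sb_within_run[of b t] t n by (auto simp del: sb.simps)
    have "q + q' \<le> ?D t + ?a (Suc t) * ?D (Suc t)"
      unfolding qq using t(3) by (intro add_left_mono mult_right_mono) auto
    also have "\<dots> = ?D (t + 2)" by simp
    finally have le: "q + q' \<le> ?D (t + 2)" .
    have "?D (t + 2) < ?D (t + 3)"
    proof -
      have "1 * ?D (t + 2) \<le> ?a (t + 2) * ?D (t + 2)"
        using pos[of "t + 1"] by (intro mult_right_mono) auto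
      moreover have "?D (t + 3) = ?a (t + 2) * ?D (t + 2) + ?D (t + 1)"
        by (simp add: numeral_3_eq_3 numeral_2_eq_2)
      moreover have "1 \<le> ?D (t + 1)" using cf_den_pos[of ?a t, OF pos] by simp
      ultimately show ?thesis by linarith
    qed
    \<comment> \<open>Makes \<open>Suc n + Suc k\<close> the depth one step after run t + 2, so that
      the exponent n + k + 1 of the gap is S_x(t + 2).\<close>
    define k where "k = pq_sum x (t + 2) - Suc n"
    have "pq_sum x (t + 2) = pq_sum x t + ?a (Suc t) + ?a (Suc (Suc t))" by (simp add: pq_sum_Suc)
    then have k: "Suc n + Suc k = pq_sum x (t + 2) + 1" "n + k + 1 = pq_sum x (t + 2)"
      using t pos[of "Suc t"] unfolding k_def by linarith+
    obtain a c a' c' where s': "sb x (Suc n + Suc k) = ((a, c), (a', c'))" by (metis surj_pair)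
    have "1 \<le> ?a (Suc (t + 2))" by (rule pos)
    from sb_within_run[OF this] s' have "c = ?D (t + 3) \<and> c' = ?D (t + 2) + ?D (t + 3) \<or>
        c' = ?D (t + 3) \<and> c = ?D (t + 2) + ?D (t + 3)"
      unfolding k(1) by (auto simp: numeral_3_eq_3 simp del: sb.simps)
    then have new: "c \<noteq> q + q'" "c' \<noteq> q + q'" using le \<open>?D (t + 2) < ?D (t + 3)\<close> by auto
    have "real (?D (Suc t) * ?D t) \<le> real (q * q')"
      unfolding qq by (intro of_nat_mono) (simp add: algebra_simps)
    then have "real (?D (Suc t) * ?D t) / 2 ^ pq_sum x (t + 2) \<le> real (q * q') / 2 ^ (n + k + 1)"
      unfolding k by (intro divide_right_mono) auto
    then have "C < (question_mark (x + \<delta>) - question_mark x) / \<delta>"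
      using T[OF t(1)] separated_slope_lower[OF n(2) s' new mem sep] by linarith
    then show "ereal C < ereal ((question_mark (x + \<delta>) - question_mark x) / \<delta>)" by simp
  qed
qed

end

section \<open>Points with prescribed partial quotients\<close>

text \<open>The values [0; a_1, ..., a_n + y] with y in the closed unit interval. Closedness gives
  compactness; the unwanted endpoints are excluded afterwards.\<close>

fun cf_cylinder :: "(nat \<Rightarrow> nat) \<Rightarrow> nat \<Rightarrow> real set" where
  "cf_cylinder a 0 = {0..1}"
| "cf_cylinder a (Suc n) = (\<lambda>y. 1 / (real (a 1) + y)) ` cf_cylinder (\<lambda>i. a (Suc i)) n"

lemma cf_cylinder_subset: "(\<And>t. 1 \<le> a (Suc t)) \<Longrightarrow> cf_cylinder a n \<subseteq> {0..1}"
proof (induction n arbitrary: a)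
  case (Suc n)
  have "cf_cylinder (\<lambda>i. a (Suc i)) n \<subseteq> {0..1}" by (intro Suc.IH Suc.prems)
  then show ?case using Suc.prems[of 0] by (auto simp: divide_le_eq)
qed simp

lemma cf_cylinder_decreasing: "(\<And>t. 1 \<le> a (Suc t)) \<Longrightarrow> cf_cylinder a (Suc n) \<subseteq> cf_cylinder a n"
proof (induction n arbitrary: a)
  case 0
  then show ?case using cf_cylinder_subset[of a 1] by auto
next
  case (Suc n)
  have "cf_cylinder (\<lambda>i. a (Suc i)) (Suc n) \<subseteq> cf_cylinder (\<lambda>i. a (Suc i)) n" by (intro Suc.IH Suc.prems)
  then show ?case unfolding cf_cylinder.simps(2)[of a] by (rule image_mono)
qed

lemma cf_cylinder_compact: "(\<And>t. 1 \<le> a (Suc t)) \<Longrightarrow> compact (cf_cylinder a n) \<and> cf_cylinder a n \<noteq> {}"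
proof (induction n arbitrary: a)
  case (Suc n)
  have "cf_cylinder (\<lambda>i. a (Suc i)) n \<subseteq> {0..1}" by (intro cf_cylinder_subset Suc.prems)
  then have "continuous_on (cf_cylinder (\<lambda>i. a (Suc i)) n) (\<lambda>y. 1 / (real (a 1) + y))"
    using Suc.prems[of 0] by (intro continuous_intros) fastforce
  then show ?case using Suc by (auto intro!: compact_continuous_image)
qed auto

lemma cf_cylinder_step:
  assumes a: "\<And>t. 1 \<le> a (Suc t)" and x: "\<And>n. x \<in> cf_cylinder a n"
  shows "1 / x - real (a 1) \<in> cf_cylinder (\<lambda>i. a (Suc i)) n" "0 < x"
proof -
  obtain y where y: "x = 1 / (real (a 1) + y)" "y \<in> cf_cylinder (\<lambda>i. a (Suc i)) n"
    using x[of "Suc n"] by auto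
  moreover have "0 \<le> y" using cf_cylinder_subset[of "\<lambda>i. a (Suc i)" n] a y by auto
  moreover have "1 \<le> real (a 1)" using a[of 0] by simp
  ultimately show "1 / x - real (a 1) \<in> cf_cylinder (\<lambda>i. a (Suc i)) n" "0 < x" by auto
qed

text \<open>The Gauss map performs a step of the Euclidean algorithm: it sends m/n in (0,1) to (n
  mod m)/m, whose denominator is smaller.\<close>

lemma rational_gauss_orbit_leaves:
  assumes "x = real m / real n"
  shows "\<exists>t. (gauss_map ^^ t) x \<notin> {0<..<1}"
  using assms
proof (induction n arbitrary: x m rule: less_induct)
  case (less n)
  show ?case
  proof (cases "x \<in> {0<..<1}")
    case True
    then have n: "0 < n" using less.prems by (cases n) auto
    have m: "0 < m" "m < n" using True n unfolding less.prems by (auto simp: zero_less_divide_iff)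
    have "gauss_map x = frac (real n / real m)" unfolding less.prems gauss_map_def by simp
    also have "real n / real m = real (n div m) + real (n mod m) / real m"
    proof -
      have "real n = real m * real (n div m) + real (n mod m)"
        by (simp flip: of_nat_mult of_nat_add)
      then show ?thesis using m by (simp add: field_simps)
    qed
    also have "frac \<dots> = real (n mod m) / real m"
      using m by (simp add: frac_unique_iff)
    finally obtain t where "(gauss_map ^^ t) (gauss_map x) \<notin> {0<..<1}" using less.IH m by blast
    then show ?thesis by (intro exI[of _ "Suc t"]) (simp add: funpow_swap1)
  next
    case False
    then show ?thesis by (intro exI[of _ 0]) simp
  qed
qed

text \<open>The nested compact cylinders have a common point, which is irrational because its Gauss
  orbit never leaves (0,1).\<close>

theorem cf_exists:
  assumes a: "\<And>t. 1 \<le> a (Suc t)"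
  obtains x where "x \<in> {0<..<1}" "x \<notin> \<rat>" "\<And>t. partial_quotient x (Suc t) = a (Suc t)"
proof -
  let ?sh = "\<lambda>t i. a (i + t)"
  have dec: "cf_cylinder a n \<subseteq> cf_cylinder a m" if "m \<le> n" for m n
    by (rule lift_Suc_antimono_le[OF _ that]) (intro cf_cylinder_decreasing a)
  have "\<Inter> (range (cf_cylinder a)) \<noteq> {}"
    using cf_cylinder_compact[of a, OF a] dec by (intro compact_nest) auto
  then obtain x where x: "\<And>n. x \<in> cf_cylinder a n" by auto
  have step: "0 < y \<and> y < 1 \<and> nat \<lfloor>1 / y\<rfloor> = a (Suc t) \<and> (\<forall>n. gauss_map y \<in> cf_cylinder (?sh (Suc t)) n)"
    if y: "\<And>n. y \<in> cf_cylinder (?sh t) n" for t y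
  proof -
    define z where "z = 1 / y - real (a (Suc t))"
    have z: "z \<in> cf_cylinder (?sh (Suc t)) n" for n
      using cf_cylinder_step(1)[of "?sh t" y n] a y by (simp add: z_def)
    have y0: "0 < y" using cf_cylinder_step(2)[of "?sh t" y] a y by simp
    have z0: "0 < z" using cf_cylinder_step(2)[of "?sh (Suc t)" z] a z by simp
    \<comment> \<open>The value z = 1 has to be excluded for the floor to be right; positivity one
      Gauss step later yields z a_(t+2) < 1.\<close>
    have "1 / z - real (a (Suc (Suc t))) \<in> cf_cylinder (?sh (Suc (Suc t))) n" for n
      using cf_cylinder_step(1)[of "?sh (Suc t)" z n] a z by simp
    then have "0 < 1 / z - real (a (Suc (Suc t)))"
      using cf_cylinder_step(2)[of "?sh (Suc (Suc t))" "1 / z - real (a (Suc (Suc t)))"] a by simp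
    then have "z * real (a (Suc (Suc t))) < 1" using z0 by (simp add: field_simps)
    moreover have "z * 1 \<le> z * real (a (Suc (Suc t)))" using a[of "Suc t"] z0 by (intro mult_left_mono) auto
    ultimately have z1: "z < 1" by linarith
    have e: "1 / y = real (a (Suc t)) + z" by (simp add: z_def)
    have fl: "\<lfloor>1 / y\<rfloor> = int (a (Suc t))" unfolding e using z0 z1 by (simp add: floor_eq_iff)
    have "1 < 1 / y" unfolding e using z0 a[of t] by linarith
    then have "y < 1" using y0 by (simp add: field_simps)
    moreover have "gauss_map y = z" unfolding gauss_map_def frac_def fl z_def by simp
    ultimately show ?thesis using y0 fl z by simp
  qed
  have orbit: "(gauss_map ^^ t) x \<in> cf_cylinder (?sh t) n" for t n
  proof (induction t arbitrary: n)
    case 0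
    then show ?case using x by simp
  next
    case (Suc t)
    then show ?case using step[of "(gauss_map ^^ t) x" t] by simp
  qed
  note st = step[OF orbit]
  show thesis
  proof
    show x01: "x \<in> {0<..<1}" using st[of 0] by simp
    show "x \<notin> \<rat>"
    proof
      assume "x \<in> \<rat>"
      then obtain m n where "\<bar>x\<bar> = real m / real n" by (metis Rats_abs_nat_div_natE)
      then have "x = real m / real n" using x01 by simp
      then show False using rational_gauss_orbit_leaves st by (metis greaterThanLessThan_iff)
    qed
    show "partial_quotient x (Suc t) = a (Suc t)" for t
      using st[of t] by (simp add: partial_quotient_def)
  qed
qed

section \<open>Growth of continuants\<close>

definition golden :: real where "golden = (1 + sqrt 5) / 2"

lemma golden_square: "golden\<^sup>2 = golden + 1" and golden_gt_1: "1 < golden"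
proof -
  show "golden\<^sup>2 = golden + 1" by (simp add: golden_def power2_eq_square field_simps)
  have "1 < sqrt 5" by simp
  then show "1 < golden" by (simp add: golden_def)
qed

lemma kappa1_golden: "kappa1 * ln 2 = 2 * ln golden"
  by (simp add: kappa1_def golden_def)

lemma kappa1_gt_1: "1 < kappa1"
proof -
  have "2 < golden\<^sup>2" using golden_square golden_gt_1 by simp
  then have "ln 2 < ln (golden\<^sup>2)" using golden_gt_1 by simp
  also have "\<dots> = kappa1 * ln 2" using golden_gt_1 by (simp add: ln_realpow kappa1_golden)
  finally show ?thesis by simp
qed

text \<open>Growth is slowest when all partial quotients are 1, the Fibonacci case. The factor
  \<open>golden\<close> on the right makes both base cases hold.\<close>

lemma cf_den_ge_golden:
  assumes a: "\<And>t. 1 \<le> a (Suc t)"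
  shows "golden ^ t \<le> golden * real (cf_den a (Suc t))"
proof (induction t rule: induct_nat_012, goal_cases)
  case 1
  show ?case using golden_gt_1 by simp
next
  case 2
  have "golden * 1 \<le> golden * real (a (Suc 0))" using golden_gt_1 a[of 0] by (intro mult_left_mono) auto
  then show ?case by simp
next
  case (3 t)
  have "golden ^ Suc (Suc t) = golden ^ t * golden\<^sup>2" by (simp add: power2_eq_square mult_ac)
  also have "\<dots> = golden ^ Suc t + golden ^ t" by (simp add: golden_square algebra_simps)
  also have "\<dots> \<le> golden * real (cf_den a (Suc (Suc t)) + cf_den a (Suc t))"
    using 3 by (simp add: algebra_simps)
  also have "\<dots> \<le> golden * real (cf_den a (Suc (Suc (Suc t))))"
    using golden_gt_1 a[of "Suc t"]
    by (intro mult_left_mono of_nat_mono) (auto simp: mult_eq_if simp del: of_nat_add)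
  finally show ?case .
qed

lemma (in irrational_unit) derivative_infinity_of_limsup:
  assumes "limsup (\<lambda>t. ereal (real (pq_sum x t) / real t)) < ereal kappa1"
  shows "has_extended_derivative question_mark \<infinity> x"
proof (rule question_mark_derivative_infinity)
  let ?D = "cf_den (partial_quotient x)"
  obtain c where c: "limsup (\<lambda>t. ereal (real (pq_sum x t) / real t)) < ereal c" "c < kappa1"
    using ereal_dense2[OF assms] by auto
  \<comment> \<open>The net exponential rate: q_t q_(t-1) is at least of order golden^(2t) =
    2^(kappa1 t), the power of two eventually at most of order 2^(c t).\<close>
  define d where "d = kappa1 * ln 2 - c * ln 2"
  have d: "d > 0" using c by (simp add: d_def)
  have ev: "eventually (\<lambda>t. real (pq_sum x t) / real t < c) sequentially"
    using Limsup_lessD[OF c(1)] by simp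
  show "filterlim (\<lambda>t. real (?D (Suc t) * ?D t) / 2 ^ pq_sum x (t + 2)) at_top sequentially"
  proof (rule filterlim_at_top_mono)
    \<comment> \<open>Of the three factors \<open>golden\<close> two come from
      \<open>cf_den_ge_golden\<close> and one from the index t - 1; the other constant pays for
      S_x(t + 2) instead of S_x(t).\<close>
    show "filterlim (\<lambda>t. exp (d * real t) / (golden ^ 3 * exp (2 * c * ln 2))) at_top sequentially"
      using d golden_gt_1 by real_asymp
    show "eventually (\<lambda>t. exp (d * real t) / (golden ^ 3 * exp (2 * c * ln 2)) \<le>
        real (?D (Suc t) * ?D t) / 2 ^ pq_sum x (t + 2)) sequentially"
      using eventually_gt_at_top[of 0] sequentially_offset[OF ev, of 2]
    proof eventually_elim
      case (elim t)
      have g0: "golden > 0" using golden_gt_1 by simp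
      obtain s where s: "t = Suc s" using elim(1) by (cases t) auto
      have "golden ^ t * golden ^ s \<le> (golden * real (?D (Suc t))) * (golden * real (?D t))"
        unfolding s using g0 by (intro mult_mono cf_den_ge_golden partial_quotient_pos) auto
      then have "golden ^ t * golden ^ s * golden \<le> golden ^ 3 * real (?D (Suc t) * ?D t)"
        using g0 by (simp add: power3_eq_cube mult_ac)
      also have "golden ^ t * golden ^ s * golden = golden ^ (2 * t)"
        by (simp add: s mult_2_right power_add mult_ac)
      also have "golden ^ (2 * t) = exp (kappa1 * ln 2 * real t)"
        using g0 by (simp add: kappa1_golden exp_of_nat2_mult powr_realpow[symmetric] powr_def mult_ac)
      finally have num: "exp (kappa1 * ln 2 * real t) / golden ^ 3 \<le> real (?D (Suc t) * ?D t)"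
        using g0 by (simp add: divide_le_eq mult_ac)
      have "real (pq_sum x (t + 2)) \<le> c * real (t + 2)"
        using elim(2) by (simp add: field_simps)
      then have "real (pq_sum x (t + 2)) * ln 2 \<le> c * real (t + 2) * ln 2" by (intro mult_right_mono) auto
      moreover have "(2::real) ^ pq_sum x (t + 2) = exp (real (pq_sum x (t + 2)) * ln 2)"
        by (simp add: powr_realpow[symmetric] powr_def)
      ultimately have den: "(2::real) ^ pq_sum x (t + 2) \<le> exp (c * real (t + 2) * ln 2)" by simp
      have "exp (d * real t) / (golden ^ 3 * exp (2 * c * ln 2)) =
          exp (kappa1 * ln 2 * real t) / golden ^ 3 / exp (c * real (t + 2) * ln 2)"
      proof -
        have "d * real t = kappa1 * ln 2 * real t - c * real t * ln 2"
          "c * real (t + 2) * ln 2 = c * real t * ln 2 + 2 * c * ln 2"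
          by (simp_all add: d_def algebra_simps)
        then show ?thesis by (simp add: exp_add exp_diff)
      qed
      also have "\<dots> \<le> real (?D (Suc t) * ?D t) / 2 ^ pq_sum x (t + 2)"
        using num den g0 by (intro frac_le) auto
      finally show ?case .
    qed
  qed
qed

section \<open>Growth rates for partial quotients 4 and 5, and kappa2\<close>

definition lam4 :: real where "lam4 = 2 + sqrt 5"
definition lam5 :: real where "lam5 = (5 + sqrt 29) / 2"

lemma lam4_square: "lam4 * lam4 = 4 * lam4 + 1" and lam5_square: "lam5 * lam5 = 5 * lam5 + 1"
  by (simp_all add: lam4_def lam5_def field_simps)

lemma lam4_bounds: "4.236 < lam4" "lam4 < 4.2361" and lam5_bounds: "5.1925 < lam5" "lam5 < 5.1926"
proof -
  have "2.236 < sqrt 5" "5.385 < sqrt 29"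
    by (rule real_less_rsqrt, simp add: power2_eq_square)+
  moreover have "sqrt 5 < 2.2361" "sqrt 29 < 5.3852"
    by (rule real_less_lsqrt, simp, simp add: power2_eq_square)+
  ultimately show "4.236 < lam4" "lam4 < 4.2361" "5.1925 < lam5" "lam5 < 5.1926"
    by (simp_all add: lam4_def lam5_def)
qed

definition rho :: real where "rho = lam5 / lam4"

lemma rho_bounds: "1.2257 < rho" "rho < 1.2259"
  using lam4_bounds lam5_bounds by (simp_all add: rho_def field_simps)

text \<open>Raising S_x(t) by one multiplies the bound for q_t^2 by rho^2 and the power of two by 2;
  this is the logarithm of the resulting loss.\<close>

definition gap_rate :: real where "gap_rate = ln 2 - 2 * ln rho"

lemma gap_rate_pos: "0 < gap_rate"
proof -
  have "rho\<^sup>2 < 2" using rho_bounds mult_strict_mono[of rho "1.2259" rho "1.2259"] by (simp add: power2_eq_square)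
  then have "ln (rho\<^sup>2) < ln 2" using rho_bounds by simp
  then show ?thesis using rho_bounds by (simp add: gap_rate_def ln_realpow)
qed

text \<open>Identifies kappa2 as the average at which the square of lam4^t rho^(S - 4t) balances
  2^S.\<close>

lemma kappa2_gap_rate: "kappa2 * gap_rate = 2 * (ln lam4 - 4 * ln rho)"
proof -
  have l: "ln rho = ln lam5 - ln lam4" using lam4_bounds lam5_bounds by (simp add: rho_def ln_div)
  have s: "ln (sqrt 2) = ln 2 / 2" by (simp add: ln_sqrt)
  have "ln lam5 - ln lam4 - ln 2 / 2 = - (gap_rate / 2)"
    by (simp add: gap_rate_def l field_simps)
  then have "kappa2 = (4 * ln lam5 - 5 * ln lam4) / (- (gap_rate / 2))"
    unfolding kappa2_def s lam4_def[symmetric] lam5_def[symmetric] by simp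
  then show ?thesis using gap_rate_pos unfolding l by (simp add: field_simps)
qed

text \<open>By \<open>kappa2_gap_rate\<close> the bounds reduce to lam4 > 4 and lam4^4 rho^2 < 2^9.
  They ensure that the proportion of fives needed for the average kappa2 lies strictly between 0 and
  1/2.\<close>

lemma kappa2_bounds: "4 < kappa2" "kappa2 < 4.5"
proof -
  have e: "(kappa2 - 4) * gap_rate = 2 * ln lam4 - 4 * ln 2"
    using kappa2_gap_rate by (simp add: gap_rate_def algebra_simps)
  have "4\<^sup>2 < lam4\<^sup>2" using lam4_bounds by (intro power_strict_mono) auto
  then have "ln (2 ^ 4) < ln (lam4\<^sup>2)" using lam4_bounds by (subst ln_less_cancel_iff) auto
  then have "0 < (kappa2 - 4) * gap_rate"
    using lam4_bounds ln_realpow[of "2::real" 4] ln_realpow[of lam4 2] unfolding e by simp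
  then show "4 < kappa2" using gap_rate_pos by (simp add: zero_less_mult_iff)
  have "lam4 ^ 4 * rho\<^sup>2 < 4.2361 ^ 4 * 1.2259\<^sup>2"
    using lam4_bounds rho_bounds by (intro mult_strict_mono power_strict_mono) auto
  also have "\<dots> < 2 ^ 9" by (simp add: power2_eq_square power4_eq_xxxx)
  finally have "ln (lam4 ^ 4 * rho\<^sup>2) < ln (2 ^ 9)"
    using lam4_bounds rho_bounds by (subst ln_less_cancel_iff) auto
  then have "(kappa2 - 4) * gap_rate < 0.5 * gap_rate"
    using lam4_bounds rho_bounds ln_realpow[of "2::real" 9] ln_realpow[of lam4 4] ln_realpow[of rho 2]
    unfolding e by (simp add: ln_mult gap_rate_def)
  then show "kappa2 < 4.5" using gap_rate_pos by simp
qed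

text \<open>The functionals \<open>q + r / \<lambda>\<^sub>s\<close> (with \<open>1 / \<lambda>\<^sub>s = \<lambda>\<^sub>s - s\<close>) are multiplied exactly by \<open>\<lambda>\<^sub>s\<close>
  under the partial quotient \<open>s\<close>. The factor in front of the second one is the least for which
  their maximum grows at most by \<open>\<lambda>\<^sub>4\<close> and \<open>\<lambda>\<^sub>5\<close> under the partial quotients 4 and 5.\<close>

definition lam_ratio :: real where "lam_ratio = (lam4 + 1) / lam5"

definition cf_potential :: "real \<Rightarrow> real \<Rightarrow> real" where
  "cf_potential q r = max (q + (lam4 - 4) * r) (lam_ratio * (q + (lam5 - 5) * r))"

text \<open>The geometric progression through lam4 at 4 and lam5 at 5, so that a product of weights
  depends only on the number and the sum of the partial quotients. Dividing by rho^4 covers a < 4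
  without truncated subtraction.\<close>

definition pq_weight :: "nat \<Rightarrow> real" where
  "pq_weight a = lam4 / rho ^ 4 * rho ^ a"

lemma lam_ratio_bounds: "1.0083 < lam_ratio" "lam_ratio < 1.0084"
  using lam4_bounds lam5_bounds by (simp_all add: lam_ratio_def field_simps)

lemma pq_weight_Suc: "pq_weight (Suc a) = rho * pq_weight a"
  by (simp add: pq_weight_def)

lemma pq_weight_4: "pq_weight 4 = lam4" and pq_weight_5: "pq_weight 5 = lam5"
proof -
  show 4: "pq_weight 4 = lam4" using rho_bounds by (simp add: pq_weight_def)
  show "pq_weight 5 = lam5"
    using pq_weight_Suc[of 4] lam4_bounds unfolding 4 by (simp add: rho_def)
qed

lemma pq_weight_small:
  "3.455 < pq_weight 3" "2.818 < pq_weight 2" "2.298 < pq_weight 1"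
  "pq_weight 3 < lam4" "pq_weight 2 < lam4" "pq_weight 1 < lam4"
proof -
  have w: "rho * pq_weight 3 = lam4" "rho * pq_weight 2 = pq_weight 3" "rho * pq_weight 1 = pq_weight 2"
    using pq_weight_Suc[of 3] pq_weight_Suc[of 2] pq_weight_Suc[of 1] pq_weight_4
    by (simp_all add: eval_nat_numeral)
  have pos: "0 < pq_weight 3" "0 < pq_weight 2" "0 < pq_weight 1"
    using lam4_bounds rho_bounds by (auto simp: pq_weight_def)
  note r = rho_bounds(2)
  have "lam4 < 1.2259 * pq_weight 3" "pq_weight 3 < 1.2259 * pq_weight 2" "pq_weight 2 < 1.2259 * pq_weight 1"
    using mult_strict_right_mono[OF r pos(1)] mult_strict_right_mono[OF r pos(2)]
      mult_strict_right_mono[OF r pos(3)] w by simp_all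
  then show "3.455 < pq_weight 3" "2.818 < pq_weight 2" "2.298 < pq_weight 1"
    using lam4_bounds by simp_all
  have "1 * pq_weight 3 < lam4" "1 * pq_weight 2 < pq_weight 3" "1 * pq_weight 1 < pq_weight 2"
    using rho_bounds mult_strict_right_mono[of 1 rho, OF _ pos(1)] mult_strict_right_mono[of 1 rho, OF _ pos(2)]
      mult_strict_right_mono[of 1 rho, OF _ pos(3)] w by simp_all
  then show "pq_weight 3 < lam4" "pq_weight 2 < lam4" "pq_weight 1 < lam4" by simp_all
qed

text \<open>For a >= 6 this line lies above both a + 0.2361 and 1.0084 (a + 0.1926), the
  coefficients that \<open>cf_potential_step\<close> has to dominate. It is nearly tight at a = 6;
  from there multiplication by rho outgrows it.\<close>

lemma pq_weight_large: "6 \<le> a \<Longrightarrow> 51 / 50 * real a + 23 / 100 < pq_weight a"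
proof (induction a rule: dec_induct)
  case base
  have "1.2257 * 5.1925 < rho * lam5" using rho_bounds lam5_bounds by (intro mult_strict_mono) auto
  moreover have "pq_weight 6 = rho * lam5" using pq_weight_Suc[of 5] pq_weight_5 by simp
  ultimately show ?case by simp
next
  case (step a)
  have "12257 / 10000 * (51 / 50 * real a + 23 / 100) < rho * pq_weight a"
    using rho_bounds step by (intro mult_strict_mono) auto
  moreover have "51 / 50 * (1 + y) + 23 / 100 < 12257 / 10000 * (51 / 50 * y + 23 / 100)" if "6 \<le> y" for y :: real
    using that by (simp add: field_simps)
  from this[of "real a"] have "51 / 50 * real (Suc a) + 23 / 100 < 12257 / 10000 * (51 / 50 * real a + 23 / 100)"
    using step by simp
  ultimately show ?case unfolding pq_weight_Suc by (rule less_trans[rotated])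
qed

text \<open>Each of the two new functionals is linear in q and r, so it is compared with one old
  functional on the cone 0 <= r <= q: the second one for a = 5, the first one otherwise.\<close>

lemma cf_potential_step:
  fixes q r :: real
  assumes a: "1 \<le> a" and r: "0 \<le> r" "r \<le> q"
  shows "cf_potential (real a * q + r) q \<le> pq_weight a * cf_potential q r"
proof -
  note B = lam4_bounds lam5_bounds lam_ratio_bounds
  have q: "0 \<le> q" using r by simp
  let ?l4 = "q + (lam4 - 4) * r" and ?l5 = "lam_ratio * (q + (lam5 - 5) * r)"
  have rat: "lam5 * lam_ratio = lam4 + 1" using B by (simp add: lam_ratio_def)
  have W0: "0 < pq_weight a" using B rho_bounds by (simp add: pq_weight_def)
  have V: "pq_weight a * ?l4 \<le> pq_weight a * cf_potential q r"
    "pq_weight a * ?l5 \<le> pq_weight a * cf_potential q r"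
    using W0 by (simp_all add: cf_potential_def)
  have goal: ?thesis
    if "real a * q + r + (lam4 - 4) * q \<le> pq_weight a * cf_potential q r"
      "lam_ratio * (real a * q + r + (lam5 - 5) * q) \<le> pq_weight a * cf_potential q r"
    using that by (simp add: cf_potential_def)
  consider "a \<le> 3" | "a = 4" | "a = 5" | "6 \<le> a" by linarith
  then show ?thesis
  proof cases
    case 1
    have vals: "real a + 0.2361 + 1 < 1.236 * pq_weight a" "1.0084 * (real a + 0.1926 + 1) < 1.236 * pq_weight a"
      "pq_weight a < lam4"
    proof -
      have "a = 1 \<or> a = 2 \<or> a = 3" using 1 a by linarith
      then show "real a + 0.2361 + 1 < 1.236 * pq_weight a" "1.0084 * (real a + 0.1926 + 1) < 1.236 * pq_weight a"
        "pq_weight a < lam4" using pq_weight_small B by auto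
    qed
    have "pq_weight a * (lam4 - 4) \<le> lam4 * (lam4 - 4)" using vals B by (intro mult_right_mono) auto
    also have "\<dots> = 1" using lam4_square by (simp add: algebra_simps)
    finally have one: "pq_weight a * (lam4 - 4) \<le> 1" .
    \<comment> \<open>Here the coefficient of r on the left is at least the one on the right, so r =
      q is the worst case.\<close>
    have lin: "c * q + e * r \<le> pq_weight a * ?l4" if "1 \<le> e" "c + e \<le> 1.236 * pq_weight a" for c e
    proof -
      have "(e - pq_weight a * (lam4 - 4)) * r \<le> (e - pq_weight a * (lam4 - 4)) * q"
        using that one r by (intro mult_left_mono) auto
      moreover have "1.236 * pq_weight a \<le> (lam4 - 3) * pq_weight a" using B W0 by (intro mult_right_mono) auto
      then have "(c + e) * q \<le> ((lam4 - 3) * pq_weight a) * q" using that q by (intro mult_right_mono) auto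
      ultimately show ?thesis by (simp add: algebra_simps)
    qed
    show ?thesis
    proof (rule goal)
      show "real a * q + r + (lam4 - 4) * q \<le> pq_weight a * cf_potential q r"
        using lin[of 1 "real a + lam4 - 4"] V vals B by (simp add: algebra_simps)
      have "lam_ratio * (real a + lam5 - 5 + 1) \<le> 1.0084 * (real a + 0.1926 + 1)"
        using B by (intro mult_mono) auto
      then show "lam_ratio * (real a * q + r + (lam5 - 5) * q) \<le> pq_weight a * cf_potential q r"
        using lin[of lam_ratio "lam_ratio * (real a + lam5 - 5)"] V vals B by (simp add: algebra_simps)
    qed
  next
    case 2
    have "pq_weight a * ?l4 = lam4 * q + (lam4 * lam4 - 4 * lam4) * r"
      unfolding 2 pq_weight_4 by (simp add: algebra_simps)
    then have W: "pq_weight a * ?l4 = lam4 * q + r" unfolding lam4_square by simp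
    show ?thesis
    proof (rule goal)
      show "real a * q + r + (lam4 - 4) * q \<le> pq_weight a * cf_potential q r"
        using V(1)[unfolded W] unfolding 2 by (simp add: algebra_simps)
      \<comment> \<open>With the chosen \<open>lam_ratio\<close> the inequality for the second
        functional becomes an equality at r = q.\<close>
      have "(lam_ratio - 1) * r \<le> (lam_ratio - 1) * q" using r B by (intro mult_left_mono) auto
      moreover have "lam_ratio * lam5 * q = (lam4 + 1) * q" using rat by (simp add: mult.commute)
      ultimately have "lam_ratio * (real a * q + r + (lam5 - 5) * q) \<le> lam4 * q + r"
        unfolding 2 by (simp add: algebra_simps)
      then show "lam_ratio * (real a * q + r + (lam5 - 5) * q) \<le> pq_weight a * cf_potential q r"
        using V(1) unfolding W by simp
    qed
  next
    case 3
    have W: "pq_weight a * ?l5 = (lam4 + 1) * (q + (lam5 - 5) * r)"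
      using rat unfolding 3 pq_weight_5 by (simp flip: mult.assoc)
    show ?thesis
    proof (rule goal)
      have "5 * 0.1925 \<le> (lam4 + 1) * (lam5 - 5)" using B by (intro mult_mono) auto
      \<comment> \<open>At r = 0 the new first functional is (lam4 + 1) q on both sides, which is
        what determines \<open>lam_ratio\<close>; only the coefficients of r remain to be
        compared.\<close>
      then have "1 * r \<le> ((lam4 + 1) * (lam5 - 5)) * r"
        using mult_mono[of "5.236" "lam4 + 1" "0.1925" "lam5 - 5"] B r by (intro mult_right_mono) auto
      then show "real a * q + r + (lam4 - 4) * q \<le> pq_weight a * cf_potential q r"
        using V(2)[unfolded W] unfolding 3 by (simp add: algebra_simps)
      have "lam5 * lam_ratio * (q + (lam5 - 5) * r) = lam_ratio * (lam5 * q + (lam5 * lam5 - 5 * lam5) * r)"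
        by (simp add: algebra_simps)
      then have "lam_ratio * (real a * q + r + (lam5 - 5) * q) = lam5 * lam_ratio * (q + (lam5 - 5) * r)"
        unfolding lam5_square 3 by (simp add: algebra_simps)
      then show "lam_ratio * (real a * q + r + (lam5 - 5) * q) \<le> pq_weight a * cf_potential q r"
        using V(2) unfolding W rat by simp
    qed
  next
    case 4
    have a6: "6 \<le> real a" using 4 by simp
    note w = pq_weight_large[OF 4]
    have "6.35 * 0.236 \<le> pq_weight a * (lam4 - 4)" using w a6 B by (intro mult_mono) auto
    then have one: "1.0084 \<le> pq_weight a * (lam4 - 4)" by simp
    \<comment> \<open>For large a the comparison holds coefficient by coefficient.\<close>
    have lin: "c * q + e * r \<le> pq_weight a * ?l4" if "e \<le> 1.0084" "c \<le> pq_weight a" for c e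
    proof -
      have "e * r \<le> pq_weight a * (lam4 - 4) * r" using that one r by (intro mult_right_mono) auto
      moreover have "c * q \<le> pq_weight a * q" using that q by (intro mult_right_mono) auto
      ultimately show ?thesis by (simp add: algebra_simps)
    qed
    show ?thesis
    proof (rule goal)
      show "real a * q + r + (lam4 - 4) * q \<le> pq_weight a * cf_potential q r"
        using lin[of 1 "real a + lam4 - 4"] V w B a6 by (simp add: algebra_simps)
      have "lam_ratio * (real a + lam5 - 5) \<le> 1.0084 * (real a + 0.1926)"
        using B by (intro mult_mono) auto
      then show "lam_ratio * (real a * q + r + (lam5 - 5) * q) \<le> pq_weight a * cf_potential q r"
        using lin[of lam_ratio "lam_ratio * (real a + lam5 - 5)"] V w B a6 by (simp add: algebra_simps)
    qed
  qed
qed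

text \<open>The potential dominates q_t and starts at \<open>lam_ratio\<close>, its value for q = 1
  and r = 0.\<close>

lemma cf_den_upper:
  assumes a: "\<And>t. 1 \<le> a (Suc t)"
  shows "real (cf_den a (Suc t)) \<le> lam_ratio * (\<Prod>i = 1..t. pq_weight (a i))"
proof -
  have "cf_potential (cf_den a (Suc t)) (cf_den a t) \<le> lam_ratio * (\<Prod>i = 1..t. pq_weight (a i))"
  proof (induction t)
    case 0
    show ?case using lam_ratio_bounds by (simp add: cf_potential_def)
  next
    case (Suc t)
    have "cf_potential (cf_den a (Suc (Suc t))) (cf_den a (Suc t)) \<le>
        pq_weight (a (Suc t)) * cf_potential (cf_den a (Suc t)) (cf_den a t)"
      using cf_potential_step[of "a (Suc t)" "cf_den a t" "cf_den a (Suc t)"] a[of t] cf_den_mono_Suc[of a t, OF a]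
      by simp
    also have "\<dots> \<le> pq_weight (a (Suc t)) * (lam_ratio * (\<Prod>i = 1..t. pq_weight (a i)))"
      using Suc rho_bounds lam4_bounds by (intro mult_left_mono) (auto simp: pq_weight_def)
    finally show ?case by (simp add: mult_ac)
  qed
  moreover have "real (cf_den a (Suc t)) \<le> cf_potential (cf_den a (Suc t)) (cf_den a t)"
    using lam4_bounds by (simp add: cf_potential_def le_max_iff_disj)
  ultimately show ?thesis by linarith
qed

section \<open>Comparison of the weights with powers of two\<close>

lemma prod_pq_weight:
  "(\<Prod>i = 1..t. pq_weight (a i)) = exp (real t * (ln lam4 - 4 * ln rho) + real (\<Sum>i = 1..t. a i) * ln rho)"
proof (induction t)
  case (Suc t)
  have "pq_weight (a (Suc t)) = exp ((ln lam4 - 4 * ln rho) + real (a (Suc t)) * ln rho)"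
    using rho_bounds lam4_bounds
    by (simp add: pq_weight_def exp_add exp_diff powr_realpow[symmetric] powr_def mult.commute)
  then show ?case using Suc by (simp add: algebra_simps flip: exp_add)
qed simp

lemma weight_square_over_power2:
  "(exp (t * (ln lam4 - 4 * ln rho) + real S * ln rho))\<^sup>2 / 2 ^ S = exp (gap_rate * (kappa2 * t - real S))"
proof -
  have "(2::real) ^ S = exp (real S * ln 2)" by (simp add: powr_realpow[symmetric] powr_def)
  then have "(exp (t * (ln lam4 - 4 * ln rho) + real S * ln rho))\<^sup>2 / 2 ^ S =
      exp (2 * (t * (ln lam4 - 4 * ln rho) + real S * ln rho) - real S * ln 2)"
    by (simp only: exp_diff exp_double)
  also have "2 * (t * (ln lam4 - 4 * ln rho) + real S * ln rho) - real S * ln 2 =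
      t * (kappa2 * gap_rate) - gap_rate * real S"
    unfolding kappa2_gap_rate by (simp add: gap_rate_def algebra_simps)
  finally show ?thesis by (simp add: algebra_simps)
qed

lemma (in irrational_unit) derivative_zero_of_liminf:
  assumes "ereal kappa2 < liminf (\<lambda>t. ereal (real (pq_sum x t) / real t))"
  shows "has_extended_derivative question_mark 0 x"
proof (rule question_mark_derivative_zero)
  let ?D = "cf_den (partial_quotient x)"
  obtain c where c: "ereal c < liminf (\<lambda>t. ereal (real (pq_sum x t) / real t))" "kappa2 < c"
    using ereal_dense2[OF assms] by auto
  have ev: "eventually (\<lambda>t. c < real (pq_sum x t) / real t) sequentially"
    using less_LiminfD[OF c(1)] by simp
  define d where "d = gap_rate * (c - kappa2)"
  have d: "d > 0" using c gap_rate_pos by (simp add: d_def)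
  show "(\<lambda>t. (real (?D (Suc t)))\<^sup>2 / 2 ^ pq_sum x t) \<longlonglongrightarrow> 0"
  proof (rule tendsto_sandwich[OF _ _ tendsto_const])
    show "eventually (\<lambda>t. 0 \<le> (real (?D (Suc t)))\<^sup>2 / 2 ^ pq_sum x t) sequentially" by simp
    show "(\<lambda>t. lam_ratio\<^sup>2 * exp (- d * real t)) \<longlonglongrightarrow> 0" using d by real_asymp
    show "eventually (\<lambda>t. (real (?D (Suc t)))\<^sup>2 / 2 ^ pq_sum x t \<le> lam_ratio\<^sup>2 * exp (- d * real t)) sequentially"
      using ev eventually_gt_at_top[of 0]
    proof eventually_elim
      case (elim t)
      let ?E = "exp (real t * (ln lam4 - 4 * ln rho) + real (pq_sum x t) * ln rho)"
      have "real (?D (Suc t)) \<le> lam_ratio * ?E"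
        using cf_den_upper[of "partial_quotient x" t, OF partial_quotient_pos]
        unfolding prod_pq_weight pq_sum_def .
      then have "(real (?D (Suc t)))\<^sup>2 \<le> (lam_ratio * ?E)\<^sup>2" by (intro power_mono) auto
      then have "(real (?D (Suc t)))\<^sup>2 / 2 ^ pq_sum x t \<le> (lam_ratio * ?E)\<^sup>2 / 2 ^ pq_sum x t"
        by (intro divide_right_mono) auto
      also have "\<dots> = lam_ratio\<^sup>2 * exp (gap_rate * (kappa2 * real t - real (pq_sum x t)))"
        unfolding power_mult_distrib times_divide_eq_right[symmetric] weight_square_over_power2 ..
      also have "\<dots> \<le> lam_ratio\<^sup>2 * exp (- d * real t)"
      proof -
        have "c * real t \<le> real (pq_sum x t)" using elim by (simp add: field_simps)
        then have "gap_rate * (kappa2 * real t - real (pq_sum x t)) \<le> gap_rate * (kappa2 * real t - c * real t)"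
          using gap_rate_pos by (intro mult_left_mono) auto
        then show ?thesis by (intro mult_left_mono) (auto simp: d_def algebra_simps)
      qed
      finally show ?case .
    qed
  qed
qed

section \<open>Points of critical average\<close>

lemma filterlim_floor_sqrt: "filterlim floor_sqrt at_top sequentially"
  unfolding filterlim_at_top
proof
  fix Z
  show "eventually (\<lambda>t. Z \<le> floor_sqrt t) sequentially"
    using eventually_ge_at_top[of "Z\<^sup>2"] by eventually_elim (rule le_floor_sqrtI)
qed

text \<open>With j the integer square root of t, j^2 <= t < (j + 1)^2 squeezes the average between
  D(j)/(j + 1)^2 and D(j + 1)/j^2.\<close>

lemma average_of_square_blocks:
  fixes D N :: "nat \<Rightarrow> nat"
  assumes lim: "(\<lambda>j. real (D j) / (real j)\<^sup>2) \<longlonglongrightarrow> \<alpha>"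
    and N: "\<And>t. D (floor_sqrt t) \<le> N t" "\<And>t. N t \<le> D (Suc (floor_sqrt t))"
  shows "(\<lambda>t. real (N t) / real t) \<longlonglongrightarrow> \<alpha>"
proof (rule tendsto_sandwich)
  have "(\<lambda>j. real (D j) / (real j)\<^sup>2 * ((real j)\<^sup>2 / (real (Suc j))\<^sup>2)) \<longlonglongrightarrow> \<alpha> * 1"
    by (intro tendsto_mult lim) real_asymp
  from filterlim_compose[OF this filterlim_floor_sqrt]
  show "(\<lambda>t. real (D (floor_sqrt t)) / (real (floor_sqrt t))\<^sup>2 *
      ((real (floor_sqrt t))\<^sup>2 / (real (Suc (floor_sqrt t)))\<^sup>2)) \<longlonglongrightarrow> \<alpha>" by simp
  have "(\<lambda>j. real (D (Suc j)) / (real (Suc j))\<^sup>2 * ((real (Suc j))\<^sup>2 / (real j)\<^sup>2)) \<longlonglongrightarrow> \<alpha> * 1"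
    by (intro tendsto_mult LIMSEQ_Suc[OF lim]) real_asymp
  from filterlim_compose[OF this filterlim_floor_sqrt]
  show "(\<lambda>t. real (D (Suc (floor_sqrt t))) / (real (Suc (floor_sqrt t)))\<^sup>2 *
      ((real (Suc (floor_sqrt t)))\<^sup>2 / (real (floor_sqrt t))\<^sup>2)) \<longlonglongrightarrow> \<alpha>" by simp
  show "eventually (\<lambda>t. real (D (floor_sqrt t)) / (real (floor_sqrt t))\<^sup>2 *
      ((real (floor_sqrt t))\<^sup>2 / (real (Suc (floor_sqrt t)))\<^sup>2) \<le> real (N t) / real t) sequentially"
    using eventually_gt_at_top[of 0]
  proof eventually_elim
    case (elim t)
    define j where "j = floor_sqrt t"
    have "j > 0" using elim by (simp add: j_def)
    then have "real (D j) / (real j)\<^sup>2 * ((real j)\<^sup>2 / (real (Suc j))\<^sup>2) = real (D j) / real ((Suc j)\<^sup>2)" by simp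
    also have "\<dots> \<le> real (N t) / real t"
      using N(1)[of t] Suc_floor_sqrt_power2_gt[of t] elim
      unfolding j_def by (intro frac_le of_nat_mono) auto
    finally show ?case unfolding j_def .
  qed
  show "eventually (\<lambda>t. real (N t) / real t \<le> real (D (Suc (floor_sqrt t))) / (real (Suc (floor_sqrt t)))\<^sup>2 *
      ((real (Suc (floor_sqrt t)))\<^sup>2 / (real (floor_sqrt t))\<^sup>2)) sequentially"
    using eventually_gt_at_top[of 0]
  proof eventually_elim
    case (elim t)
    define j where "j = floor_sqrt t"
    have "j > 0" using elim by (simp add: j_def)
    then have "real (N t) / real t \<le> real (D (Suc j)) / real (j\<^sup>2)"
      using N(2)[of t] floor_sqrt_power2_le[of t]
      unfolding j_def by (intro frac_le of_nat_mono) auto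
    also have "\<dots> = real (D (Suc j)) / (real (Suc j))\<^sup>2 * ((real (Suc j))\<^sup>2 / (real j)\<^sup>2)" by simp
    finally show ?case unfolding j_def .
  qed
qed

lemma floor_sqrt_square_bounds: "(floor_sqrt t)\<^sup>2 \<le> t" "t \<le> (floor_sqrt t)\<^sup>2 + 2 * floor_sqrt t"
  using floor_sqrt_power2_le[of t] Suc_floor_sqrt_power2_gt[of t] by (auto simp: power2_eq_square)

lemma cf_den_cong: "(\<And>t. a (Suc t) = b (Suc t)) \<Longrightarrow> cf_den a n = cf_den b n"
  by (induction a n rule: cf_den.induct) auto

lemma sum_of_increments:
  fixes N :: "nat \<Rightarrow> nat"
  assumes "mono N" "N 0 = 0"
  shows "(\<Sum>i = 1..t. c + (N i - N (i - 1))) = c * t + N t"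
proof (induction t)
  case (Suc t)
  have "N t \<le> N (Suc t)" using assms(1) by (simp add: monoD)
  then show ?case using Suc by simp
qed (simp add: assms)

text \<open>The functional q_t + q_(t-1)/golden is multiplied exactly by \<open>golden\<close> under
  the partial quotient 1 and at most by a golden under a, so a large exception costs only its own
  size.\<close>

lemma cf_den_le_golden:
  assumes a: "\<And>t. 1 \<le> a (Suc t)"
  shows "real (cf_den a (Suc t)) \<le> golden ^ t * real (\<Prod>i = 1..t. a i)"
proof -
  note g = golden_gt_1 golden_square
  have "real (cf_den a (Suc t)) + (golden - 1) * real (cf_den a t) \<le> golden ^ t * real (\<Prod>i = 1..t. a i)"
  proof (induction t)
    case (Suc t)
    define q r A where "q = real (cf_den a (Suc t))" and "r = real (cf_den a t)" and "A = real (a (Suc t))"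
    have nn: "0 \<le> q" "0 \<le> r" "1 \<le> A" using a[of t] by (auto simp: q_def r_def A_def)
    have "0 \<le> (A - 1) * (golden - 1) * q" "0 \<le> (A - 1) * r" using nn g(1) by simp_all
    then have "(A * q + r) + (golden - 1) * q \<le> A * golden * q + A * r" by (simp add: algebra_simps)
    also have "\<dots> = A * golden * q + A * (golden\<^sup>2 - golden) * r" by (simp add: g(2))
    also have "\<dots> = A * golden * (q + (golden - 1) * r)" by (simp add: algebra_simps power2_eq_square)
    also have "\<dots> \<le> A * golden * (golden ^ t * real (\<Prod>i = 1..t. a i))"
      using Suc nn g unfolding q_def r_def by (intro mult_left_mono) auto
    finally show ?case by (simp add: q_def r_def A_def mult_ac)
  qed simp
  moreover have "0 \<le> (golden - 1) * real (cf_den a t)" using g(1) by simp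
  ultimately show ?thesis by linarith
qed

text \<open>A factor differs from 1 only at a square, so at most \<open>floor_sqrt t\<close> of them
  count.\<close>

lemma prod_increments_le:
  fixes E :: "nat \<Rightarrow> nat"
  assumes "mono E"
  shows "(\<Prod>i = 1..t. 1 + (E (floor_sqrt i) - E (floor_sqrt (i - 1)))) \<le> (1 + E (floor_sqrt t)) ^ floor_sqrt t"
proof (induction t)
  case (Suc t)
  let ?P = "\<Prod>i = 1..t. 1 + (E (floor_sqrt i) - E (floor_sqrt (i - 1)))"
  show ?case
  proof (cases "floor_sqrt (Suc t) = floor_sqrt t")
    case True
    then show ?thesis using Suc by simp
  next
    case False
    then have s: "floor_sqrt (Suc t) = Suc (floor_sqrt t)" by (simp add: floor_sqrt_Suc split: if_splits)
    have "?P * (1 + (E (floor_sqrt (Suc t)) - E (floor_sqrt t))) \<le>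
        (1 + E (floor_sqrt t)) ^ floor_sqrt t * (1 + E (floor_sqrt (Suc t)))"
      using Suc by (intro mult_mono) auto
    also have "\<dots> \<le> (1 + E (floor_sqrt (Suc t))) ^ floor_sqrt t * (1 + E (floor_sqrt (Suc t)))"
      using monoD[OF assms, of "floor_sqrt t" "floor_sqrt (Suc t)"] s
      by (intro mult_right_mono power_mono) auto
    finally show ?thesis by (simp add: s mult_ac)
  qed
qed simp

lemma exists_derivative_zero_at_kappa1:
  "\<exists>x::real. x \<in> {0<..<1} \<and> x \<notin> \<rat> \<and> (\<lambda>t. real (pq_sum x t) / real t) \<longlonglongrightarrow> kappa1 \<and>
    has_extended_derivative question_mark 0 x"
proof -
  define \<alpha> where "\<alpha> = kappa1 - 1"
  have \<alpha>: "\<alpha> > 0" using kappa1_gt_1 by (simp add: \<alpha>_def)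
  \<comment> \<open>The surplus j sqrt j has to beat the O(j) variation of \<alpha> t between j^2
    and (j + 1)^2 and the O(j log j) contributed by the exceptions.\<close>
  define h where "h = (\<lambda>j::nat. \<alpha> * (real j)\<^sup>2 + real j * sqrt (real j))"
  define E where "E = (\<lambda>j. nat \<lceil>h j\<rceil>)"
  have h_mono: "h i \<le> h j" if "i \<le> j" for i j
    unfolding h_def using \<alpha> that by (intro add_mono mult_left_mono mult_mono power_mono) auto
  have h0: "0 \<le> h j" for j using \<alpha> by (simp add: h_def)
  have E_mono: "mono E"
    unfolding E_def by (intro monoI nat_mono ceiling_mono h_mono)
  have E_bounds: "h j \<le> real (E j)" "real (E j) \<le> h j + 1" for j
    using h0[of j] unfolding E_def by linarith+
  have E00: "E 0 = 0" by (simp add: E_def h_def)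
  have E_lim: "(\<lambda>j. real (E j) / (real j)\<^sup>2) \<longlonglongrightarrow> \<alpha>"
  proof (rule tendsto_sandwich)
    show "(\<lambda>j. h j / (real j)\<^sup>2) \<longlonglongrightarrow> \<alpha>" "(\<lambda>j. (h j + 1) / (real j)\<^sup>2) \<longlonglongrightarrow> \<alpha>"
      unfolding h_def using \<alpha> by real_asymp+
  qed (use E_bounds in \<open>auto intro!: divide_right_mono always_eventually\<close>)
  define N where "N = (\<lambda>t. E (floor_sqrt t))"
  have N: "mono N" "N 0 = 0"
    using E_mono mono_floor_sqrt E00 by (auto simp: N_def mono_def)
  have N_lim: "(\<lambda>t. real (N t) / real t) \<longlonglongrightarrow> \<alpha>"
    by (rule average_of_square_blocks[OF E_lim]) (auto simp: N_def intro: monoD[OF E_mono])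
  \<comment> \<open>All partial quotients are 1 except possibly at squares j^2, where E(j) - E(j -
    1) is added.\<close>
  define a where "a = (\<lambda>t. 1 + (N t - N (t - 1)))"
  have a1: "1 \<le> a (Suc t)" for t by (simp add: a_def)
  obtain x where x: "x \<in> {0<..<1}" "x \<notin> \<rat>" and pq: "\<And>t. partial_quotient x (Suc t) = a (Suc t)"
    using cf_exists[of a, OF a1] by blast
  interpret irrational_unit x by unfold_locales (use x in auto)
  have den: "cf_den (partial_quotient x) n = cf_den a n" for n
    using pq by (rule cf_den_cong)
  have S: "pq_sum x t = t + N t" for t
  proof -
    have "pq_sum x t = (\<Sum>i = 1..t. a i)"
      unfolding pq_sum_def by (rule sum.cong) (use pq in \<open>auto simp: Suc_le_eq gr0_conv_Suc\<close>)
    then show ?thesis using sum_of_increments[OF N, of 1 t] by (simp add: a_def)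
  qed
  have avg: "(\<lambda>t. real (pq_sum x t) / real t) \<longlonglongrightarrow> kappa1"
  proof (rule Lim_transform_eventually)
    show "(\<lambda>t. 1 + real (N t) / real t) \<longlonglongrightarrow> kappa1"
      using tendsto_add[OF tendsto_const N_lim, of 1] by (simp add: \<alpha>_def)
    show "eventually (\<lambda>t. 1 + real (N t) / real t = real (pq_sum x t) / real t) sequentially"
      using eventually_gt_at_top[of 0] by eventually_elim (simp add: S field_simps)
  qed
  \<comment> \<open>The first term bounds the logarithm of the squared product of the exceptions;
    the second comes from \<alpha> t - E(j) <= \<alpha> (j^2 + 2 j) - h(j).\<close>
  define B where "B = (\<lambda>j::nat. exp (2 * real j * ln (2 + h j) + ln 2 * (2 * \<alpha> * real j - real j * sqrt (real j))))"
  have B_lim: "B \<longlonglongrightarrow> 0" unfolding B_def h_def using \<alpha> by real_asymp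
  have bound: "(real (cf_den a (Suc t)))\<^sup>2 / 2 ^ pq_sum x t \<le> B (floor_sqrt t)" for t
  proof -
    define j where "j = floor_sqrt t"
    have g0: "0 < golden" using golden_gt_1 by simp
    have h2: "0 < 2 + h j" using h0[of j] by simp
    have "(\<Prod>i = 1..t. a i) \<le> (1 + E j) ^ j"
      using prod_increments_le[OF E_mono, of t] by (simp add: a_def N_def j_def)
    then have "real (\<Prod>i = 1..t. a i) \<le> real ((1 + E j) ^ j)" by (rule of_nat_mono)
    also have "\<dots> = (1 + real (E j)) ^ j" by simp
    also have "\<dots> \<le> (2 + h j) ^ j" using E_bounds[of j] by (intro power_mono) auto
    also have "\<dots> = exp (real j * ln (2 + h j))" using h2 by (simp add: powr_realpow[symmetric] powr_def)
    finally have P: "real (\<Prod>i = 1..t. a i) \<le> exp (real j * ln (2 + h j))" .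
    have gt: "golden ^ t = exp (real t * ln golden)" using g0 by (simp add: powr_realpow[symmetric] powr_def)
    have "real (cf_den a (Suc t)) \<le> golden ^ t * real (\<Prod>i = 1..t. a i)"
      by (rule cf_den_le_golden[of a, OF a1])
    also have "\<dots> \<le> exp (real t * ln golden) * exp (real j * ln (2 + h j))"
      unfolding gt using P by (intro mult_left_mono) auto
    finally have "(real (cf_den a (Suc t)))\<^sup>2 \<le> (exp (real t * ln golden + real j * ln (2 + h j)))\<^sup>2"
      by (intro power_mono) (auto simp: exp_add)
    also have "\<dots> = exp (2 * (real t * ln golden + real j * ln (2 + h j)))" by (simp only: exp_double)
    also have "\<dots> = exp (kappa1 * ln 2 * real t + 2 * real j * ln (2 + h j))"
      unfolding kappa1_golden by (simp add: algebra_simps)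
    finally have num: "(real (cf_den a (Suc t)))\<^sup>2 \<le> exp (kappa1 * ln 2 * real t + 2 * real j * ln (2 + h j))" .
    have pow: "(2::real) ^ pq_sum x t = exp (real (pq_sum x t) * ln 2)"
      by (simp add: powr_realpow[symmetric] powr_def)
    have "real t \<le> real (j\<^sup>2 + 2 * j)" using floor_sqrt_square_bounds(2)[of t] unfolding j_def by (rule of_nat_mono)
    then have "\<alpha> * real t \<le> \<alpha> * ((real j)\<^sup>2 + 2 * real j)" using \<alpha> by (intro mult_left_mono) auto
    then have "kappa1 * real t - real (pq_sum x t) \<le> 2 * \<alpha> * real j - real j * sqrt (real j)"
      using E_bounds(1)[of j] unfolding S N_def j_def[symmetric] \<alpha>_def h_def by (simp add: algebra_simps)
    then have ex: "ln 2 * (kappa1 * real t - real (pq_sum x t)) \<le> ln 2 * (2 * \<alpha> * real j - real j * sqrt (real j))"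
      by (intro mult_left_mono) auto
    have "(real (cf_den a (Suc t)))\<^sup>2 / 2 ^ pq_sum x t \<le>
        exp (kappa1 * ln 2 * real t + 2 * real j * ln (2 + h j)) / exp (real (pq_sum x t) * ln 2)"
      unfolding pow by (intro divide_right_mono num) auto
    also have "\<dots> = exp (2 * real j * ln (2 + h j) + ln 2 * (kappa1 * real t - real (pq_sum x t)))"
      by (simp add: algebra_simps flip: exp_diff)
    also have "\<dots> \<le> B j" unfolding B_def using ex by simp
    finally show ?thesis unfolding j_def .
  qed
  have "has_extended_derivative question_mark 0 x"
  proof (rule question_mark_derivative_zero, unfold den, rule tendsto_sandwich[OF _ _ tendsto_const])
    show "(\<lambda>t. B (floor_sqrt t)) \<longlonglongrightarrow> 0" using filterlim_compose[OF B_lim filterlim_floor_sqrt] .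
  qed (use bound in auto)
  then show ?thesis using x avg by blast
qed

section \<open>Blocks of fives and fours\<close>

text \<open>Passing from the functional of the partial quotient 4 to that of 5 costs a factor \<open>rho\<close>;
  \<open>J\<close> counts these passages.\<close>

lemma cf_den_lower:
  assumes a45: "\<And>t. a (Suc t) = 4 \<or> a (Suc t) = 5"
    and J: "\<And>t. J t \<le> J (Suc t)"
    and switch: "\<And>t. a (Suc t) = 4 \<Longrightarrow> a (Suc (Suc t)) = 5 \<Longrightarrow> Suc (J t) \<le> J (Suc t)"
  shows "(\<Prod>i = 1..t. pq_weight (a i)) / rho ^ Suc (J t) \<le> 2 * real (cf_den a (Suc t))"
proof -
  note B = lam4_bounds lam5_bounds rho_bounds
  have a1: "1 \<le> a (Suc t)" for t using a45[of t] by auto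
  define R where "R = (\<lambda>t. (\<Prod>i = 1..t. pq_weight (a i)) / rho ^ Suc (J t))"
  define l where "l = (\<lambda>c t. real (cf_den a (Suc t)) + c * real (cf_den a t))"
  have l_mono: "l (lam5 - 5) t \<le> l (lam4 - 4) t" for t
    using B unfolding l_def by (intro add_left_mono mult_right_mono) auto
  have l_switch: "l (lam4 - 4) t \<le> rho * l (lam5 - 5) t" for t
  proof -
    \<comment> \<open>Because lam4 (lam4 - 4) = 1 = lam5 (lam5 - 5).\<close>
    have "rho * (lam5 - 5) = lam4 - 4"
    proof -
      have "lam5 * (lam5 - 5) = lam4 * (lam4 - 4)"
        using lam4_square lam5_square by (simp add: algebra_simps)
      then show ?thesis using B by (simp add: rho_def field_simps)
    qed
    then have "rho * l (lam5 - 5) t = rho * real (cf_den a (Suc t)) + (lam4 - 4) * real (cf_den a t)"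
      unfolding l_def by (simp add: distrib_left mult.assoc[symmetric])
    moreover have "1 * real (cf_den a (Suc t)) \<le> rho * real (cf_den a (Suc t))"
      using B by (intro mult_right_mono) auto
    ultimately show ?thesis by (simp add: l_def)
  qed
  have l_step: "l (lam4 - 4) (Suc t) = lam4 * l (lam4 - 4) t" if "a (Suc t) = 4" for t
  proof -
    have "lam4 * l (lam4 - 4) t = lam4 * real (cf_den a (Suc t)) + (lam4 * lam4 - 4 * lam4) * real (cf_den a t)"
      by (simp add: l_def algebra_simps)
    then show ?thesis unfolding lam4_square using that by (simp add: l_def algebra_simps)
  qed
  have l_step5: "l (lam5 - 5) (Suc t) = lam5 * l (lam5 - 5) t" if "a (Suc t) = 5" for t
  proof -
    have "lam5 * l (lam5 - 5) t = lam5 * real (cf_den a (Suc t)) + (lam5 * lam5 - 5 * lam5) * real (cf_den a t)"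
      by (simp add: l_def algebra_simps)
    then show ?thesis unfolding lam5_square using that by (simp add: l_def algebra_simps)
  qed
  have R0: "0 \<le> (\<Prod>i = 1..t. pq_weight (a i))" for t
    using B by (intro prod_nonneg) (auto simp: pq_weight_def)
  have R_Suc: "R (Suc t) \<le> pq_weight (a (Suc t)) * R t"
    "Suc (J t) \<le> J (Suc t) \<Longrightarrow> rho * R (Suc t) \<le> pq_weight (a (Suc t)) * R t" for t
  proof -
    have pos: "0 \<le> pq_weight (a (Suc t)) * (\<Prod>i = 1..t. pq_weight (a i))"
      using R0[of "Suc t"] by (simp add: mult.commute)
    have "pq_weight (a (Suc t)) * (\<Prod>i = 1..t. pq_weight (a i)) / rho ^ Suc (J (Suc t)) \<le>
        pq_weight (a (Suc t)) * (\<Prod>i = 1..t. pq_weight (a i)) / rho ^ Suc (J t)"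
      using pos B J[of t] by (intro divide_left_mono power_increasing mult_pos_pos) auto
    then show "R (Suc t) \<le> pq_weight (a (Suc t)) * R t" by (simp add: R_def mult_ac)
    assume "Suc (J t) \<le> J (Suc t)"
    then have "pq_weight (a (Suc t)) * (\<Prod>i = 1..t. pq_weight (a i)) / rho ^ J (Suc t) \<le>
        pq_weight (a (Suc t)) * (\<Prod>i = 1..t. pq_weight (a i)) / rho ^ Suc (J t)"
      using pos B by (intro divide_left_mono power_increasing mult_pos_pos) auto
    then show "rho * R (Suc t) \<le> pq_weight (a (Suc t)) * R t" using B by (simp add: R_def mult_ac)
  qed
  \<comment> \<open>The bound is kept for the functional of the partial quotient to come, which that
    quotient multiplies exactly. Changing from 5 to 4 is free, since the functional of 4 is the
    larger one.\<close>
  have "if a (Suc t) = 5 then R t \<le> l (lam5 - 5) t else R t \<le> l (lam4 - 4) t"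
  proof (induction t)
    case 0
    have "1 \<le> rho ^ Suc (J 0)" using B by (intro one_le_power) auto
    then have "R 0 \<le> 1" by (simp add: R_def)
    then show ?case by (simp add: l_def)
  next
    case (Suc t)
    from a45[of t] show ?case
    proof
      assume 4: "a (Suc t) = 4"
      have le: "pq_weight (a (Suc t)) * R t \<le> l (lam4 - 4) (Suc t)"
        using Suc 4 B unfolding l_step[OF 4] 4 pq_weight_4 by simp
      show ?case
      proof (cases "a (Suc (Suc t)) = 5")
        case True
        then have "rho * R (Suc t) \<le> rho * l (lam5 - 5) (Suc t)"
          using R_Suc(2)[OF switch[OF 4 True]] le l_switch[of "Suc t"] by linarith
        then show ?thesis using True B by simp
      next
        case False
        then show ?thesis using R_Suc(1)[of t] le by simp
      qed
    next
      assume 5: "a (Suc t) = 5"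
      have "pq_weight (a (Suc t)) * R t \<le> l (lam5 - 5) (Suc t)"
        using Suc 5 B unfolding l_step5[OF 5] 5 pq_weight_5 by simp
      then show ?case using R_Suc(1)[of t] l_mono[of "Suc t"] by auto
    qed
  qed
  then have "R t \<le> l (lam4 - 4) t" using l_mono[of t] by (auto split: if_splits)
  also have "\<dots> \<le> real (cf_den a (Suc t)) + 1 * real (cf_den a t)"
    unfolding l_def using B by (intro add_left_mono mult_right_mono) auto
  also have "\<dots> \<le> 2 * real (cf_den a (Suc t))" using cf_den_mono_Suc[of a t, OF a1] by simp
  finally show ?thesis unfolding R_def .
qed

lemma exists_derivative_infinity_at_kappa2:
  "\<exists>x::real. x \<in> {0<..<1} \<and> x \<notin> \<rat> \<and> (\<lambda>t. real (pq_sum x t) / real t) \<longlonglongrightarrow> kappa2 \<and>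
    has_extended_derivative question_mark \<infinity> x"
proof -
  define \<alpha> where "\<alpha> = kappa2 - 4"
  have \<alpha>: "0 < \<alpha>" "\<alpha> < 1/2" using kappa2_bounds by (simp_all add: \<alpha>_def)
  \<comment> \<open>The deficit j sqrt j has to outweigh the factor rho^(j + 1) lost at the switches
    and the O(j) variation within a block. For small j it makes h negative, and then E is 0.\<close>
  define h where "h = (\<lambda>j::nat. \<alpha> * (real j)\<^sup>2 - real j * sqrt (real j))"
  define E where "E = (\<lambda>j. nat \<lfloor>h j\<rfloor>)"
  have h_factor: "h j = real j * sqrt (real j) * (\<alpha> * sqrt (real j) - 1)" for j
    by (simp add: h_def power2_eq_square algebra_simps)
  have E_Suc: "E j \<le> E (Suc j)" for j
  proof (cases "h j \<le> 0")
    case True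
    then have "\<lfloor>h j\<rfloor> \<le> 0" by linarith
    then show ?thesis by (simp add: E_def)
  next
    case False
    have "0 \<le> real j * sqrt (real j)" by simp
    \<comment> \<open>Although h is not monotone near 0, once it is positive all factors in
      \<open>h_factor\<close> are nonnegative and increasing.\<close>
    then have "0 \<le> \<alpha> * sqrt (real j) - 1"
      using False unfolding h_factor by (metis linear mult_nonneg_nonpos)
    then have "h j \<le> h (Suc j)"
      unfolding h_factor using \<alpha> by (intro mult_mono diff_mono mult_left_mono) auto
    then show ?thesis unfolding E_def by (intro nat_mono floor_mono)
  qed
  have E_mono: "mono E" using E_Suc by (simp add: mono_iff_le_Suc)
  have E_lower: "h j < real (E j) + 1" and E_upper: "0 \<le> h j \<Longrightarrow> real (E j) \<le> h j" for j
    unfolding E_def by linarith+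
  have E00: "E 0 = 0" by (simp add: E_def h_def)
  \<comment> \<open>The fives of block j must fit into the 2 j + 1 places between j^2 and (j + 1)^2;
    this is where \<alpha> < 1/2 enters.\<close>
  have E_incr: "E (Suc j) \<le> E j + (2 * j + 1)" for j
  proof (cases "h (Suc j) \<le> 0")
    case True
    then have "\<lfloor>h (Suc j)\<rfloor> \<le> 0" by linarith
    then show ?thesis by (simp add: E_def)
  next
    case False
    have "real j * sqrt (real j) \<le> real (Suc j) * sqrt (real (Suc j))" by (intro mult_mono) auto
    then have "h (Suc j) \<le> h j + \<alpha> * (2 * real j + 1)"
      by (simp add: h_def power2_eq_square algebra_simps)
    also have "\<alpha> * (2 * real j + 1) \<le> 1/2 * (2 * real j + 1)" using \<alpha> by (intro mult_right_mono) auto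
    finally have "h (Suc j) \<le> h j + (real j + 1/2)" by (simp add: field_simps)
    moreover have "real (E (Suc j)) \<le> h (Suc j)" using E_upper False by simp
    ultimately have "real (E (Suc j)) < real (E j) + real j + 2" using E_lower[of j] by linarith
    then show ?thesis by linarith
  qed
  have h_pos: "eventually (\<lambda>j. 0 \<le> h j) sequentially"
    unfolding h_def using \<alpha> by real_asymp
  have E_lim: "(\<lambda>j. real (E j) / (real j)\<^sup>2) \<longlonglongrightarrow> \<alpha>"
  proof (rule tendsto_sandwich)
    show "(\<lambda>j. (h j - 1) / (real j)\<^sup>2) \<longlonglongrightarrow> \<alpha>" "(\<lambda>j. h j / (real j)\<^sup>2) \<longlonglongrightarrow> \<alpha>"
      unfolding h_def using \<alpha> by real_asymp+
    show "eventually (\<lambda>j. (h j - 1) / (real j)\<^sup>2 \<le> real (E j) / (real j)\<^sup>2) sequentially"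
      using E_lower by (intro always_eventually allI divide_right_mono) (auto simp: algebra_simps less_imp_le)
    show "eventually (\<lambda>j. real (E j) / (real j)\<^sup>2 \<le> h j / (real j)\<^sup>2) sequentially"
      using h_pos by eventually_elim (intro divide_right_mono E_upper, auto)
  qed
  \<comment> \<open>The number of fives up to t when block j begins with its E(j + 1) - E(j) fives
    and continues with fours.\<close>
  define N where "N = (\<lambda>t. E (floor_sqrt t) + min (t - (floor_sqrt t)\<^sup>2) (E (Suc (floor_sqrt t)) - E (floor_sqrt t)))"
  have N_Suc: "N (Suc t) = N t + (if t - (floor_sqrt t)\<^sup>2 < E (Suc (floor_sqrt t)) - E (floor_sqrt t) then 1 else 0)" for t
  proof -
    define j where "j = floor_sqrt t"
    have j: "j\<^sup>2 \<le> t" "t \<le> j\<^sup>2 + 2 * j" using floor_sqrt_square_bounds[of t] by (simp_all add: j_def)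
    show ?thesis
    proof (cases "floor_sqrt (Suc t) = j")
      case True
      then show ?thesis using j unfolding N_def j_def[symmetric] True by (auto simp: Suc_diff_le)
    next
      case False
      then have s: "floor_sqrt (Suc t) = Suc j" by (simp add: floor_sqrt_Suc j_def split: if_splits)
      then have "(Suc j)\<^sup>2 \<le> Suc t" using floor_sqrt_power2_le[of "Suc t"] by simp
      \<comment> \<open>At the last index of the block, \<open>E_incr\<close> ensures that the count
        reaches E(j + 1) exactly at the next square.\<close>
      then have t: "t = j\<^sup>2 + 2 * j" using j by (simp add: power2_eq_square)
      have "Suc t = (Suc j)\<^sup>2" by (simp add: t power2_eq_square)
      then have "N (Suc t) = E (Suc j)" unfolding N_def s by simp
      moreover have "N t = E j + min (2 * j) (E (Suc j) - E j)" unfolding N_def j_def[symmetric] by (simp add: t)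
      ultimately show ?thesis using E_Suc[of j] E_incr[of j] unfolding j_def[symmetric] by (auto simp: t)
    qed
  qed
  have N: "mono N" "N 0 = 0"
    using N_Suc by (simp add: mono_iff_le_Suc) (simp add: N_def E00)
  have N_le: "N t \<le> E (Suc (floor_sqrt t))" for t
    using E_Suc[of "floor_sqrt t"] by (simp add: N_def)
  have N_lim: "(\<lambda>t. real (N t) / real t) \<longlonglongrightarrow> \<alpha>"
    by (rule average_of_square_blocks[OF E_lim _ N_le]) (simp add: N_def)
  define a where "a = (\<lambda>t. 4 + (N t - N (t - 1)))"
  have a_Suc: "a (Suc t) = (if t - (floor_sqrt t)\<^sup>2 < E (Suc (floor_sqrt t)) - E (floor_sqrt t) then 5 else 4)" for t
    by (simp add: a_def N_Suc)
  have a45: "a (Suc t) = 4 \<or> a (Suc t) = 5" for t by (simp add: a_Suc)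
  have a1: "1 \<le> a (Suc t)" for t by (simp add: a_Suc)
  \<comment> \<open>Within a block the fives come first, so a four is followed by a five only when a
    new block starts. Hence \<open>floor_sqrt\<close> can count the switches.\<close>
  have switch: "Suc (floor_sqrt t) \<le> floor_sqrt (Suc t)" if "a (Suc t) = 4" "a (Suc (Suc t)) = 5" for t
  proof (rule ccontr)
    assume "\<not> ?thesis"
    then have "floor_sqrt (Suc t) = floor_sqrt t" using mono_floor_sqrt'[of t "Suc t"] by simp
    then show False using that unfolding a_Suc by (auto split: if_splits)
  qed
  obtain x where x: "x \<in> {0<..<1}" "x \<notin> \<rat>" and pq: "\<And>t. partial_quotient x (Suc t) = a (Suc t)"
    using cf_exists[of a, OF a1] by blast
  interpret irrational_unit x by unfold_locales (use x in auto)
  have den: "cf_den (partial_quotient x) n = cf_den a n" for n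
    using pq by (rule cf_den_cong)
  have S_sum: "pq_sum x t = (\<Sum>i = 1..t. a i)" for t
    unfolding pq_sum_def by (rule sum.cong) (use pq in \<open>auto simp: Suc_le_eq gr0_conv_Suc\<close>)
  have S: "pq_sum x t = 4 * t + N t" for t
    unfolding S_sum a_def by (rule sum_of_increments[OF N])
  have avg: "(\<lambda>t. real (pq_sum x t) / real t) \<longlonglongrightarrow> kappa2"
  proof (rule Lim_transform_eventually)
    show "(\<lambda>t. 4 + real (N t) / real t) \<longlonglongrightarrow> kappa2"
      using tendsto_add[OF tendsto_const N_lim, of 4] by (simp add: \<alpha>_def)
    show "eventually (\<lambda>t. 4 + real (N t) / real t = real (pq_sum x t) / real t) sequentially"
      using eventually_gt_at_top[of 0] by eventually_elim (simp add: S field_simps)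
  qed
  define L where "L = ln rho"
  have L: "L > 0" using rho_bounds by (simp add: L_def)
  \<comment> \<open>24576 = 4 * 6 * 1024: the square of the 2 in \<open>cf_den_lower\<close>, the
    quotient q_t <= 6 q_(t-1), and 2^10 for two further partial quotients of at most 5.\<close>
  define B where "B = (\<lambda>j::nat. exp (gap_rate * (\<alpha> * (real j)\<^sup>2 - h (Suc j)) - 2 * real (Suc j) * L) / 24576)"
  have B_lim: "filterlim B at_top sequentially"
    unfolding B_def h_def using \<alpha> L gap_rate_pos by real_asymp
  have bound: "B (floor_sqrt t) \<le> real (cf_den a (Suc t) * cf_den a t) / 2 ^ pq_sum x (t + 2)"
    if t: "0 < t" and hp: "0 \<le> h (Suc (floor_sqrt t))" for t
  proof -
    define j where "j = floor_sqrt t"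
    have a5: "a (Suc t) \<le> 5" for t by (simp add: a_Suc)
    obtain s where s: "t = Suc s" using t by (cases t) auto
    have "a (Suc s) * cf_den a (Suc s) \<le> 5 * cf_den a (Suc s)" using a5[of s] by (rule mult_right_mono) simp
    then have six: "cf_den a (Suc t) \<le> 6 * cf_den a t"
      unfolding s cf_den.simps using cf_den_mono_Suc[of a s, OF a1] by linarith
    have "pq_sum x (t + 2) \<le> pq_sum x t + 10"
      using a5[of t] a5[of "Suc t"] by (simp add: pq_sum_Suc pq)
    then have "(2::real) ^ pq_sum x (t + 2) \<le> 2 ^ (pq_sum x t + 10)" by (intro power_increasing) auto
    then have den2: "(2::real) ^ pq_sum x (t + 2) \<le> 1024 * 2 ^ pq_sum x t" by (simp add: power_add)
    let ?W = "exp (real t * (ln lam4 - 4 * ln rho) + real (pq_sum x t) * ln rho)"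
    have "(\<Prod>i = 1..t. pq_weight (a i)) / rho ^ Suc (floor_sqrt t) \<le> 2 * real (cf_den a (Suc t))"
    proof (rule cf_den_lower)
      show "floor_sqrt t \<le> floor_sqrt (Suc t)" for t by (rule mono_floor_sqrt') simp
    qed (fact a45 switch)+
    then have "?W / rho ^ Suc j \<le> 2 * real (cf_den a (Suc t))"
      unfolding prod_pq_weight S_sum j_def .
    then have "(?W / rho ^ Suc j)\<^sup>2 \<le> (2 * real (cf_den a (Suc t)))\<^sup>2"
      using rho_bounds by (intro power_mono) auto
    then have sq: "(?W / rho ^ Suc j)\<^sup>2 / 4 \<le> (real (cf_den a (Suc t)))\<^sup>2" by (simp add: power_mult_distrib)
    have rp: "(rho ^ Suc j)\<^sup>2 = exp (2 * real (Suc j) * L)"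
    proof -
      have "rho ^ Suc j = exp (real (Suc j) * L)"
        using rho_bounds unfolding L_def by (subst powr_realpow[symmetric]) (auto simp: powr_def)
      then show ?thesis by (simp only: exp_double mult.assoc)
    qed
    have "real (N t) \<le> h (Suc j)"
      using N_le[of t] E_upper[OF hp] unfolding j_def by linarith
    moreover have "(real j)\<^sup>2 \<le> real t"
      using of_nat_mono[OF floor_sqrt_square_bounds(1)[of t]] by (simp add: j_def)
    then have "\<alpha> * (real j)\<^sup>2 \<le> \<alpha> * real t" using \<alpha> by (intro mult_left_mono) auto
    ultimately have "\<alpha> * (real j)\<^sup>2 - h (Suc j) \<le> kappa2 * real t - real (pq_sum x t)"
      unfolding S \<alpha>_def by (simp add: algebra_simps)
    then have "gap_rate * (\<alpha> * (real j)\<^sup>2 - h (Suc j)) \<le> gap_rate * (kappa2 * real t - real (pq_sum x t))"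
      using gap_rate_pos by (intro mult_left_mono) auto
    then have "B j \<le> exp (gap_rate * (kappa2 * real t - real (pq_sum x t)) - 2 * real (Suc j) * L) / 24576"
      unfolding B_def by (intro divide_right_mono) auto
    also have "\<dots> = (?W / rho ^ Suc j)\<^sup>2 / 4 / (6144 * 2 ^ pq_sum x t)"
      unfolding exp_diff rp[symmetric] weight_square_over_power2[symmetric] by (simp add: power_divide)
    also have "\<dots> \<le> (real (cf_den a (Suc t)))\<^sup>2 / (6144 * 2 ^ pq_sum x t)"
      using sq by (intro divide_right_mono) auto
    also have "\<dots> \<le> 6 * real (cf_den a (Suc t) * cf_den a t) / (6144 * 2 ^ pq_sum x t)"
    proof (rule divide_right_mono)
      have "real (cf_den a (Suc t)) * real (cf_den a (Suc t)) \<le> real (cf_den a (Suc t)) * real (6 * cf_den a t)"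
        by (intro mult_left_mono of_nat_mono six) auto
      then show "(real (cf_den a (Suc t)))\<^sup>2 \<le> 6 * real (cf_den a (Suc t) * cf_den a t)"
        by (simp add: power2_eq_square del: cf_den.simps)
    qed simp
    also have "\<dots> = real (cf_den a (Suc t) * cf_den a t) / (1024 * 2 ^ pq_sum x t)" by simp
    also have "\<dots> \<le> real (cf_den a (Suc t) * cf_den a t) / 2 ^ pq_sum x (t + 2)"
      using den2 by (intro divide_left_mono) auto
    finally show ?thesis unfolding j_def .
  qed
  have "has_extended_derivative question_mark \<infinity> x"
  proof (rule question_mark_derivative_infinity, unfold den, rule filterlim_at_top_mono)
    show "filterlim (\<lambda>t. B (floor_sqrt t)) at_top sequentially"
      using filterlim_compose[OF B_lim filterlim_floor_sqrt] .
    \<comment> \<open>Where h is negative, truncation makes E exceed h, so the bound is applied only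
      for large t.\<close>
    have "eventually (\<lambda>j. 0 \<le> h (Suc j)) sequentially"
      using h_pos eventually_sequentially_Suc[of "\<lambda>j. 0 \<le> h j"] by blast
    then have "eventually (\<lambda>t. 0 \<le> h (Suc (floor_sqrt t))) sequentially"
      by (rule eventually_compose_filterlim[OF _ filterlim_floor_sqrt])
    then show "eventually (\<lambda>t. B (floor_sqrt t) \<le>
        real (cf_den a (Suc t) * cf_den a t) / 2 ^ pq_sum x (t + 2)) sequentially"
      using eventually_gt_at_top[of 0] by eventually_elim (rule bound)
  qed
  then show ?thesis using x avg by blast
qed

theorem corollary1:
  shows
    "(\<forall>x::real. x \<in> {0<..<1} \<longrightarrow> x \<notin> \<rat> \<longrightarrow>
        limsup (\<lambda>t. ereal (real (pq_sum x t) / real t)) < ereal kappa1 \<longrightarrow>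
        has_extended_derivative question_mark \<infinity> x) \<and>
     (\<exists>x::real. x \<in> {0<..<1} \<and> x \<notin> \<rat> \<and>
        (\<lambda>t. real (pq_sum x t) / real t) \<longlonglongrightarrow> kappa1 \<and>
        has_extended_derivative question_mark 0 x) \<and>
     (\<forall>x::real. x \<in> {0<..<1} \<longrightarrow> x \<notin> \<rat> \<longrightarrow>
        liminf (\<lambda>t. ereal (real (pq_sum x t) / real t)) > ereal kappa2 \<longrightarrow>
        has_extended_derivative question_mark 0 x) \<and>
     (\<exists>x::real. x \<in> {0<..<1} \<and> x \<notin> \<rat> \<and>
        (\<lambda>t. real (pq_sum x t) / real t) \<longlonglongrightarrow> kappa2 \<and>
        has_extended_derivative question_mark \<infinity> x)"
  using irrational_unit.derivative_infinity_of_limsup irrational_unit.derivative_zero_of_liminf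
    exists_derivative_zero_at_kappa1 exists_derivative_infinity_at_kappa2
  unfolding irrational_unit_def by blast

end
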